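(* Let $\chi\in[0,1]$ and let $\{\widetilde{w^{n}},w^n,u^n\}$ be generated by the filtered projection algorithm described below (all steps assumed solvable). Then for every $l=1,2,\dots$, $$\|w^{l}\|^{2}+\sum_{n=0}^{l-1}\|w^{n+1}-\widetilde{w^{n+1}}\|^{2}+\sum_{n=0}^{l-1}\|\widetilde{w^{n+1}}-u^{n}\|^{2}+\sum_{n=0}^{l-1}\nu\triangle t\|\nabla\widetilde{w^{n+1}}\|^{2}\le\|w^{0}\|^{2}+\sum_{n=0}^{l-1}\nu^{-1}\triangle t\|f(t_{n+1})\|_{-1}^{2}.$$
   Context: $\Omega\subset\mathbb{R}^3$ bounded domain; $(\cdot,\cdot)$, $\|\cdot\|$: $L^2(\Omega)$ inner product and norm; $\|\cdot\|_{-1}$ is the norm of the dual space of $H^1_0(\Omega)^3$. $V=\{v\in H^1_0(\Omega)^3:\operatorname{div}v=0\}$, $H=\{v\in L^2(\Omega)^3:\operatorname{div}v=0,\ v\cdot n|_{\partial\Omega}=0\}$. Nonlinear differential filter: for a given smooth field $u$, indicator $a(u)$ with values in $[\varepsilon,1]$ for some $\varepsilon>0$, filtering radius $\delta$ (bounded), and $w\in L^2(\Omega)^3$, $F(u)w\in V$ solves $(\delta^2a(u)\nabla(F(u)w),\nabla v)+(F(u)w,v)=(w,v)$ for all $v\in V$. Filtered projection algorithm: time step $\triangle t$, $t_n=n\triangle t$, $f^n=f(t_n)$, viscosity $\nu>0$; start with $u^0=w^0=\widetilde{w^0}=u_0\in V$. For $n=0,1,\dots$: (1) find $\widetilde{w^{n+1}}\in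 H^1_0(\Omega)^3$ with $\frac1{\triangle t}(\widetilde{w^{n+1}}-u^n)+(w^n\cdot\nabla)\widetilde{w^{n+1}}-\nu\Delta\widetilde{w^{n+1}}=f^{n+1}$ (weakly); (2) find $w^{n+1}\in H$ and $p^{n+1}$ (zero mean) with $\frac1{\triangle t}(w^{n+1}-\widetilde{w^{n+1}})+\nabla p^{n+1}=0$, i.e. $w^{n+1}$ is the $L^2$-orthogonal projection of $\widetilde{w^{n+1}}$ onto $H$; (3) $\overline{w^{n+1}}:=F(w^{n+1})w^{n+1}$; (4) $u^{n+1}:=(1-\chi)w^{n+1}+\chi\overline{w^{n+1}}$. *)

theory Defs
  imports "HOL-Analysis.Analysis"
begin

text \<open>Points of the physical domain are in real^3; velocity fields are maps real^3 to real^3.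
  Velocity gradients are 3x3 matrices G with G $ i $ j = d_j v_i.\<close>

type_synonym point = "real^3"
type_synonym field = "real^3 \<Rightarrow> real^3"

definition partial :: "3 \<Rightarrow> (point \<Rightarrow> real) \<Rightarrow> point \<Rightarrow> real" where
  "partial j g x = frechet_derivative g (at x) (axis j 1)"

fun iter_partial :: "3 list \<Rightarrow> (point \<Rightarrow> real) \<Rightarrow> point \<Rightarrow> real" where
  "iter_partial [] g = g"
| "iter_partial (j # js) g = partial j (iter_partial js g)"

definition smooth_fun :: "(point \<Rightarrow> real) \<Rightarrow> bool" where
  "smooth_fun g \<longleftrightarrow> (\<forall>js x. iter_partial js g differentiable (at x))"

definition test_fun :: "point set \<Rightarrow> (point \<Rightarrow> real) \<Rightarrow> bool" where
  "test_fun \<Omega> g \<longleftrightarrow> smooth_fun g \<and> compact (closure {x. g x \<noteq> 0})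
      \<and> closure {x. g x \<noteq> 0} \<subseteq> \<Omega>"

definition test_field :: "point set \<Rightarrow> field \<Rightarrow> bool" where
  "test_field \<Omega> \<phi> \<longleftrightarrow> (\<forall>i. test_fun \<Omega> (\<lambda>x. \<phi> x $ i))"

definition grad_test :: "(point \<Rightarrow> real) \<Rightarrow> point \<Rightarrow> real^3" where
  "grad_test g x = (\<chi> j. partial j g x)"

definition L2 :: "point set \<Rightarrow> (point \<Rightarrow> 'a::euclidean_space) \<Rightarrow> bool" where
  "L2 \<Omega> g \<longleftrightarrow> g \<in> borel_measurable (lebesgue_on \<Omega>)
      \<and> integrable (lebesgue_on \<Omega>) (\<lambda>x. (norm (g x))\<^sup>2)"

definition L2_inner :: "point set \<Rightarrow> (point \<Rightarrow> 'a::euclidean_space) \<Rightarrow> (point \<Rightarrow> 'a) \<Rightarrow> real" where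
  "L2_inner \<Omega> g h = (\<integral>x. g x \<bullet> h x \<partial>(lebesgue_on \<Omega>))"

definition L2_norm :: "point set \<Rightarrow> (point \<Rightarrow> 'a::euclidean_space) \<Rightarrow> real" where
  "L2_norm \<Omega> g = sqrt (\<integral>x. (norm (g x))\<^sup>2 \<partial>(lebesgue_on \<Omega>))"

definition has_weak_grad_scalar :: "point set \<Rightarrow> (point \<Rightarrow> real) \<Rightarrow> (point \<Rightarrow> real^3) \<Rightarrow> bool" where
  "has_weak_grad_scalar \<Omega> q g \<longleftrightarrow>
     (\<forall>\<phi>. test_fun \<Omega> \<phi> \<longrightarrow> (\<forall>j.
        (\<integral>x. q x * partial j \<phi> x \<partial>(lebesgue_on \<Omega>))
          = - (\<integral>x. g x $ j * \<phi> x \<partial>(lebesgue_on \<Omega>))))"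

definition H1_scalar :: "point set \<Rightarrow> (point \<Rightarrow> real) \<Rightarrow> bool" where
  "H1_scalar \<Omega> q \<longleftrightarrow> L2 \<Omega> q \<and> (\<exists>g. has_weak_grad_scalar \<Omega> q g \<and> L2 \<Omega> g)"

definition wgrad_scalar :: "point set \<Rightarrow> (point \<Rightarrow> real) \<Rightarrow> point \<Rightarrow> real^3" where
  "wgrad_scalar \<Omega> q = (SOME g. has_weak_grad_scalar \<Omega> q g \<and> L2 \<Omega> g)"

definition has_weak_grad :: "point set \<Rightarrow> field \<Rightarrow> (point \<Rightarrow> real^3^3) \<Rightarrow> bool" where
  "has_weak_grad \<Omega> v G \<longleftrightarrow> (\<forall>i. has_weak_grad_scalar \<Omega> (\<lambda>x. v x $ i) (\<lambda>x. G x $ i))"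

definition H1 :: "point set \<Rightarrow> field \<Rightarrow> bool" where
  "H1 \<Omega> v \<longleftrightarrow> L2 \<Omega> v \<and> (\<exists>G. has_weak_grad \<Omega> v G \<and> L2 \<Omega> G)"

definition wgrad :: "point set \<Rightarrow> field \<Rightarrow> point \<Rightarrow> real^3^3" where
  "wgrad \<Omega> v = (SOME G. has_weak_grad \<Omega> v G \<and> L2 \<Omega> G)"

definition H1_norm :: "point set \<Rightarrow> field \<Rightarrow> real" where
  "H1_norm \<Omega> v = sqrt ((L2_norm \<Omega> v)\<^sup>2 + (L2_norm \<Omega> (wgrad \<Omega> v))\<^sup>2)"

definition H10 :: "point set \<Rightarrow> field \<Rightarrow> bool" where
  "H10 \<Omega> v \<longleftrightarrow> H1 \<Omega> v \<and> (\<exists>\<phi>::nat \<Rightarrow> field. (\<forall>k. test_field \<Omega> (\<phi> k))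
       \<and> (\<lambda>k. H1_norm \<Omega> (\<lambda>x. \<phi> k x - v x)) \<longlonglongrightarrow> 0)"

definition wdiv :: "point set \<Rightarrow> field \<Rightarrow> point \<Rightarrow> real" where
  "wdiv \<Omega> v x = (\<Sum>i\<in>UNIV. wgrad \<Omega> v x $ i $ i)"

definition Vsp :: "point set \<Rightarrow> field \<Rightarrow> bool" where
  "Vsp \<Omega> v \<longleftrightarrow> H10 \<Omega> v \<and> (AE x in lebesgue_on \<Omega>. wdiv \<Omega> v x = 0)"

text \<open>H = {v in L^2 : div v = 0 (distributionally), v.n = 0 on the boundary}.  The normal trace
  is understood in the usual weak sense (generalized Green formula): for v in L^2 with div v = 0,
  v.n = 0 means that the integral of v . grad q vanishes for every q in H^1(\<Omega>).\<close>
definition weak_div_free :: "point set \<Rightarrow> field \<Rightarrow> bool" where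
  "weak_div_free \<Omega> v \<longleftrightarrow>
     (\<forall>\<phi>. test_fun \<Omega> \<phi> \<longrightarrow> (\<integral>x. v x \<bullet> grad_test \<phi> x \<partial>(lebesgue_on \<Omega>)) = 0)"

definition normal_trace_zero :: "point set \<Rightarrow> field \<Rightarrow> bool" where
  "normal_trace_zero \<Omega> v \<longleftrightarrow>
     (\<forall>q. H1_scalar \<Omega> q \<longrightarrow> (\<integral>x. v x \<bullet> wgrad_scalar \<Omega> q x \<partial>(lebesgue_on \<Omega>)) = 0)"

definition Hsp :: "point set \<Rightarrow> field \<Rightarrow> bool" where
  "Hsp \<Omega> v \<longleftrightarrow> L2 \<Omega> v \<and> weak_div_free \<Omega> v \<and> normal_trace_zero \<Omega> v"

definition in_dual :: "point set \<Rightarrow> (field \<Rightarrow> real) \<Rightarrow> bool" where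
  "in_dual \<Omega> F \<longleftrightarrow>
     (\<forall>u v a b. H10 \<Omega> u \<longrightarrow> H10 \<Omega> v \<longrightarrow> F (\<lambda>x. a *\<^sub>R u x + b *\<^sub>R v x) = a * F u + b * F v)
     \<and> (\<exists>C. \<forall>v. H10 \<Omega> v \<longrightarrow> \<bar>F v\<bar> \<le> C * L2_norm \<Omega> (wgrad \<Omega> v))"

definition dual_norm :: "point set \<Rightarrow> (field \<Rightarrow> real) \<Rightarrow> real" where
  "dual_norm \<Omega> F = Sup {\<bar>F v\<bar> / L2_norm \<Omega> (wgrad \<Omega> v) | v. H10 \<Omega> v \<and> L2_norm \<Omega> (wgrad \<Omega> v) \<noteq> 0}"

end

(* Test the first step with wt (Suc n), the projection with w (Suc n) and the filter with
   wbar (Suc n): projection and filter do not increase the L^2 norm, so everything reduces to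
   the vanishing of the convection term ((w . grad) v, v) for v in H^1_0 and w solenoidal,
   merely in L^2.  If that integrand is integrable, v is approximated by test fields phi and w
   is paired with the gradients of the test functions s / (2 (1 + e s)), s = |phi|^2, letting
   first phi tend to v and then e tend to 0; otherwise the Bochner integral is 0 by convention.
   Since wgrad is a Hilbert choice, comparing it with classical gradients of test fields
   rests on the a.e. uniqueness of weak gradients, i.e. on the fundamental lemma of the
   calculus of variations. *)
theory Submission
  imports Defs
begin

subsection \<open>Smooth functions and bumps\<close>

text \<open>The obstacle is that w and the approximating gradients are controlled only in L^2, so
  (grad \<phi>) w is controlled only in L^1, and the factor multiplying it must be bounded
  independently of the approximant before a limit can be taken. The obvious test function |\<phi>|^2
  / 2 would leave the factor \<phi> itself there. The damped one replaces it by \<phi> / (1 + e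
  |\<phi>|^2)^2, which for fixed e > 0 is a bounded continuous function of \<phi>. This bound blows
  up as e tends to 0, which dictates the order of the two limits: the second limit is dominated by
  the undamped integrand itself and therefore needs its integrability. Since
  \<open>weak_div_free\<close> can be tested only with compactly supported smooth functions, it
  matters that the damped function vanishes wherever \<phi> does. \<open>test_fun\<close> asks for
  all iterated partial derivatives, so the smoothness of such composites, and of bumps, is derived
  from a class of functions that is closed under a single differentiation.\<close>

lemma partial_eqI:
  assumes "(g has_derivative g') (at x)"
  shows "partial j g x = g' (axis j 1)"
  unfolding partial_def using frechet_derivative_at[OF assms] by simp

lemma has_derivative_frechet:
  "g differentiable (at x) \<Longrightarrow> (g has_derivative frechet_derivative g (at x)) (at x)"
  using frechet_derivative_works by blast

text \<open>Packaging a one-variable function with all its derivatives in one family makes the rule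
  \<open>comp\<close> below stable under differentiation: the chain rule only shifts the
  index.\<close>

definition deriv_chain :: "(nat \<Rightarrow> real \<Rightarrow> real) \<Rightarrow> bool" where
  "deriv_chain h \<longleftrightarrow> (\<forall>k t. (h k has_real_derivative h (Suc k) t) (at t))"

text \<open>A certificate of smoothness: partial derivatives of members are again built by these
  rules, so all iterated derivatives are reached without higher-order Leibniz or chain
  formulas.\<close>

inductive smooth_alg :: "(point \<Rightarrow> real) \<Rightarrow> bool" where
  base: "smooth_fun f \<Longrightarrow> smooth_alg f"
| const: "smooth_alg (\<lambda>x. c)"
| coord: "smooth_alg (\<lambda>x. x $ i)"
| add: "smooth_alg f \<Longrightarrow> smooth_alg g \<Longrightarrow> smooth_alg (\<lambda>x. f x + g x)"
| mult: "smooth_alg f \<Longrightarrow> smooth_alg g \<Longrightarrow> smooth_alg (\<lambda>x. f x * g x)"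
| inverse: "smooth_alg f \<Longrightarrow> (\<And>x. f x \<noteq> 0) \<Longrightarrow> smooth_alg (\<lambda>x. inverse (f x))"
| comp: "deriv_chain h \<Longrightarrow> smooth_alg f \<Longrightarrow> smooth_alg (\<lambda>x. h k (f x))"

lemma iter_partial_snoc: "iter_partial (js @ [j]) g = iter_partial js (partial j g)"
  by (induction js) auto

lemma smooth_fun_partial: "smooth_fun g \<Longrightarrow> smooth_fun (partial j g)"
  unfolding smooth_fun_def by (metis iter_partial_snoc)

lemma smooth_fun_differentiable: "smooth_fun g \<Longrightarrow> g differentiable (at x)"
  unfolding smooth_fun_def by (metis iter_partial.simps(1))

lemma partial_add:
  assumes "f differentiable (at x)" "g differentiable (at x)"
  shows "partial j (\<lambda>x. f x + g x) x = partial j f x + partial j g x"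
  unfolding partial_def[of j f] partial_def[of j g]
  by (rule partial_eqI) (use assms has_derivative_frechet in \<open>auto intro!: derivative_eq_intros\<close>)

lemma partial_mult:
  assumes "f differentiable (at x)" "g differentiable (at x)"
  shows "partial j (\<lambda>x. f x * g x) x = partial j f x * g x + f x * partial j g x"
  unfolding partial_def[of j f] partial_def[of j g]
  by (rule partial_eqI[THEN trans])
    (use assms has_derivative_frechet in \<open>auto intro!: derivative_eq_intros\<close>)

lemma partial_comp:
  assumes "f differentiable (at x)" "(h has_real_derivative h') (at (f x))"
  shows "partial j (\<lambda>x. h (f x)) x = h' * partial j f x"
    and "(\<lambda>x. h (f x)) differentiable (at x)"
proof -
  have "((\<lambda>x. h (f x)) has_derivative (\<lambda>y. h' * frechet_derivative f (at x) y)) (at x)"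
    using has_derivative_compose[OF has_derivative_frechet[OF assms(1)], of h "\<lambda>y. h' * y"] assms(2)
    by (simp add: has_field_derivative_def)
  then show "partial j (\<lambda>x. h (f x)) x = h' * partial j f x"
    and "(\<lambda>x. h (f x)) differentiable (at x)"
    using partial_eqI unfolding partial_def[of j f] differentiable_def by blast+
qed

text \<open>Both conclusions are proved in one induction because the product and chain rules for
  \<open>partial\<close> need differentiable ingredients.\<close>

lemma smooth_alg_step:
  "smooth_alg f \<Longrightarrow> (\<forall>x. f differentiable (at x)) \<and> (\<forall>j. smooth_alg (partial j f))"
proof (induction rule: smooth_alg.induct)
  case (base f)
  then show ?case
    using smooth_fun_differentiable smooth_fun_partial smooth_alg.base by blast
next
  case (const c)
  have "partial j (\<lambda>x. c) = (\<lambda>x. 0)" for j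
    by (rule ext, rule partial_eqI[THEN trans]) (auto intro!: derivative_eq_intros)
  then show ?case by (auto intro: smooth_alg.const)
next
  case (coord i)
  have d: "((\<lambda>x. x $ i) has_derivative (\<lambda>x. x $ i)) (at x)" for x :: point
    by (rule bounded_linear_imp_has_derivative[OF bounded_linear_vec_nth])
  have "partial j (\<lambda>x. x $ i) = (\<lambda>x. axis j 1 $ i)" for j
    by (rule ext, rule partial_eqI[OF d])
  then show ?case using d by (auto intro: smooth_alg.const simp: differentiable_def)
next
  case (add f g)
  have "partial j (\<lambda>x. f x + g x) = (\<lambda>x. partial j f x + partial j g x)" for j
    using add partial_add by blast
  then show ?case using add by (auto intro: smooth_alg.add)
next
  case (mult f g)
  have "partial j (\<lambda>x. f x * g x) = (\<lambda>x. partial j f x * g x + f x * partial j g x)" for j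
    using mult partial_mult by blast
  then show ?case using mult by (auto intro!: smooth_alg.add smooth_alg.mult)
next
  case (inverse f)
  \<comment> \<open>The derivative is spelled with a constant, products and inverses only, so that
    it matches the rules of \<open>smooth_alg\<close> literally.\<close>
  have d: "(Fields.inverse has_real_derivative (- 1 * (Fields.inverse (f x) * Fields.inverse (f x)))) (at (f x))" for x
    using DERIV_inverse[of "f x"] inverse.hyps(2) by (simp add: power2_eq_square)
  have "partial j (\<lambda>x. Fields.inverse (f x)) = (\<lambda>x. (- 1 * (Fields.inverse (f x) * Fields.inverse (f x))) * partial j f x)" for j
    using partial_comp(1)[of f _ Fields.inverse, OF _ d] inverse.IH by blast
  moreover have "smooth_alg (\<lambda>x. (- 1 * (Fields.inverse (f x) * Fields.inverse (f x))) * partial j f x)" for j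
    by (intro smooth_alg.mult smooth_alg.const smooth_alg.inverse) (use inverse in auto)
  ultimately show ?case
    using partial_comp(2)[of f _ Fields.inverse, OF _ d] inverse.IH by simp
next
  case (comp h f k)
  have d: "(h k has_real_derivative (h (Suc k) (f x))) (at (f x))" for x
    using comp(1) by (simp add: deriv_chain_def)
  have "partial j (\<lambda>x. h k (f x)) = (\<lambda>x. h (Suc k) (f x) * partial j f x)" for j
    using partial_comp(1)[of f _ "h k", OF _ d] comp.IH by blast
  moreover have "smooth_alg (\<lambda>x. h (Suc k) (f x) * partial j f x)" for j
    by (rule smooth_alg.mult[OF smooth_alg.comp[OF comp.hyps]]) (use comp.IH in blast)
  ultimately show ?case
    using partial_comp(2)[of f _ "h k", OF _ d] comp.IH by simp
qed

lemma smooth_alg_imp_smooth_fun: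
  assumes "smooth_alg f"
  shows "smooth_fun f"
proof -
  have "smooth_alg (iter_partial js f)" for js
    by (induction js) (use assms smooth_alg_step in auto)
  then show ?thesis
    unfolding smooth_fun_def using smooth_alg_step by blast
qed

text \<open>For t > 0 the k-th derivative of exp (-1/t) is P_k(1/t) exp (-1/t). Differentiating once
  more, with s = 1/t, gives the recursion P_{k+1}(s) = s^2 (P_k(s) - P_k'(s)).\<close>

primrec flat_exp_poly :: "nat \<Rightarrow> real poly" where
  "flat_exp_poly 0 = 1"
| "flat_exp_poly (Suc k) = [:0, 0, 1:] * (flat_exp_poly k - pderiv (flat_exp_poly k))"

definition flat_exp :: "nat \<Rightarrow> real \<Rightarrow> real" where
  "flat_exp k t = (if t > 0 then poly (flat_exp_poly k) (1 / t) * exp (- 1 / t) else 0)"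

lemma poly_exp_decay: "((\<lambda>s. poly p s * exp (- s)) \<longlongrightarrow> (0::real)) at_top"
proof -
  have "((\<lambda>s. \<Sum>i\<le>degree p. coeff p i * (s ^ i / exp s)) \<longlongrightarrow> (\<Sum>i\<le>degree p. coeff p i * 0)) at_top"
    by (intro tendsto_intros tendsto_power_div_exp_0)
  then show ?thesis
    by (simp add: poly_altdef sum_distrib_right exp_minus divide_inverse mult.assoc)
qed

lemma deriv_chain_flat_exp: "deriv_chain flat_exp"
  unfolding deriv_chain_def
proof (intro allI)
  fix k :: nat and t :: real
  let ?p = "flat_exp_poly k"
  consider "t > 0" | "t < 0" | "t = 0" by linarith
  then show "(flat_exp k has_real_derivative flat_exp (Suc k) t) (at t)"
  proof cases
    case 1
    have "((\<lambda>t. poly ?p (1 / t) * exp (- 1 / t)) has_real_derivative flat_exp (Suc k) t) (at t)"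
      using 1 by (auto intro!: derivative_eq_intros DERIV_chain2[OF poly_DERIV]
          simp: flat_exp_def field_simps power2_eq_square)
    then show ?thesis
      by (rule has_field_derivative_transform_within_open[of _ _ _ "{0<..}"])
        (use 1 in \<open>auto simp: flat_exp_def\<close>)
  next
    case 2
    have "((\<lambda>t. 0) has_real_derivative flat_exp (Suc k) t) (at t)"
      using 2 by (simp add: flat_exp_def)
    then show ?thesis
      by (rule has_field_derivative_transform_within_open[of _ _ _ "{..<0}"])
        (use 2 in \<open>auto simp: flat_exp_def\<close>)
  next
    case 3
    \<comment> \<open>At the origin the right difference quotient \<open>flat_exp k y / y\<close>
      equals s P_k(s) exp (-s) with s = 1/y. The extra factor s is the leading \<open>0\<close> of
      \<open>pCons\<close>.\<close>
    have "((\<lambda>s. poly (pCons 0 ?p) s * exp (- s)) \<longlongrightarrow> 0) at_top"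
      by (rule poly_exp_decay)
    then have "((\<lambda>y. poly (pCons 0 ?p) (inverse y) * exp (- inverse y)) \<longlongrightarrow> 0) (at_right 0)"
      by (rule filterlim_compose[OF _ filterlim_inverse_at_top_right])
    then have "((\<lambda>y. flat_exp k y / y) \<longlongrightarrow> 0) (at_right 0)"
      by (rule Lim_transform_eventually)
        (auto simp: eventually_at_filter flat_exp_def field_simps)
    moreover have "((\<lambda>y. flat_exp k y / y) \<longlongrightarrow> 0) (at_left 0)"
      by (rule Lim_transform_eventually[of "\<lambda>_. 0"])
        (auto simp: eventually_at_filter flat_exp_def)
    ultimately have "((\<lambda>y. flat_exp k y / y) \<longlongrightarrow> 0) (at 0)"
      using filterlim_split_at by blast
    then show ?thesis
      using 3 by (simp add: has_field_derivative_iff flat_exp_def)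
  qed
qed

lemma flat_exp_0: "flat_exp 0 t = (if t > 0 then exp (- 1 / t) else 0)"
  by (simp add: flat_exp_def)

lemma smooth_alg_prod:
  "finite I \<Longrightarrow> (\<And>i. i \<in> I \<Longrightarrow> smooth_alg (f i)) \<Longrightarrow> smooth_alg (\<lambda>x. \<Prod>i\<in>I. f i x)"
  by (induction I rule: finite_induct) (auto intro: smooth_alg.const smooth_alg.mult)

text \<open>Dilating the flat exponential by \<open>Suc n\<close> drives every factor to 1 inside
  the box while keeping it 0 outside, so the bumps increase to the indicator of the open box.
  Differences are written as sums to fit the rules of \<open>smooth_alg\<close>.\<close>

definition box_bump :: "point \<Rightarrow> point \<Rightarrow> nat \<Rightarrow> point \<Rightarrow> real" where
  "box_bump a b n x =
     (\<Prod>i\<in>UNIV. flat_exp 0 (real (Suc n) * (x $ i + - a $ i)) * flat_exp 0 (real (Suc n) * (b $ i + - 1 * x $ i)))"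

lemma box_bump_eq_0:
  assumes "x \<notin> box a b"
  shows "box_bump a b n x = 0"
proof -
  obtain i where "\<not> (a $ i < x $ i \<and> x $ i < b $ i)"
    using assms by (auto simp: mem_box_cart)
  then have "flat_exp 0 (real (Suc n) * (x $ i + - a $ i)) * flat_exp 0 (real (Suc n) * (b $ i + - 1 * x $ i)) = 0"
    by (auto simp: flat_exp_0 zero_less_mult_iff)
  then show ?thesis
    unfolding box_bump_def by (subst prod_zero_iff) auto
qed

lemma abs_box_bump_le: "\<bar>box_bump a b n x\<bar> \<le> 1"
proof -
  have "0 \<le> flat_exp 0 t \<and> flat_exp 0 t \<le> 1" for t
    by (simp add: flat_exp_0)
  then have "0 \<le> box_bump a b n x \<and> box_bump a b n x \<le> 1"
    unfolding box_bump_def by (intro conjI prod_nonneg prod_le_1 ballI mult_nonneg_nonneg mult_le_one) auto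
  then show ?thesis by simp
qed

lemma flat_exp_dilation_tendsto:
  assumes "t > 0"
  shows "(\<lambda>n. flat_exp 0 (real (Suc n) * t)) \<longlonglongrightarrow> 1"
proof -
  have "(\<lambda>n. exp (- (inverse (real (Suc n)) * inverse t))) \<longlonglongrightarrow> exp (- (0 * inverse t))"
    by (intro tendsto_intros LIMSEQ_inverse_real_of_nat)
  moreover have "exp (- (inverse (real (Suc n)) * inverse t)) = flat_exp 0 (real (Suc n) * t)" for n
    using assms by (simp add: flat_exp_0 divide_inverse)
  ultimately show ?thesis by simp
qed

lemma box_bump_tendsto: "(\<lambda>n. box_bump a b n x) \<longlonglongrightarrow> indicator (box a b) x"
proof (cases "x \<in> box a b")
  case True
  have "(\<lambda>n. box_bump a b n x) \<longlonglongrightarrow> (\<Prod>i::3\<in>UNIV. 1 * 1)"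
    unfolding box_bump_def
    by (intro tendsto_prod tendsto_mult flat_exp_dilation_tendsto)
      (use True in \<open>auto simp: mem_box_cart\<close>)
  then show ?thesis using True by simp
qed (simp add: box_bump_eq_0)

lemma test_fun_box_bump:
  assumes "cbox a b \<subseteq> \<Omega>"
  shows "test_fun \<Omega> (box_bump a b n)"
proof -
  have "smooth_alg (box_bump a b n)"
    unfolding box_bump_def
    by (intro smooth_alg_prod smooth_alg.mult smooth_alg.comp[OF deriv_chain_flat_exp]
        smooth_alg.add smooth_alg.const smooth_alg.coord) auto
  moreover have "{x. box_bump a b n x \<noteq> 0} \<subseteq> cbox a b"
    using box_bump_eq_0 box_subset_cbox by blast
  then have "closure {x. box_bump a b n x \<noteq> 0} \<subseteq> cbox a b"
    by (rule closure_minimal) (rule closed_cbox)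
  ultimately show ?thesis
    using assms smooth_alg_imp_smooth_fun unfolding test_fun_def
    by (meson closed_closure compact_Int_closed compact_cbox compact_closure bounded_subset bounded_cbox closure_subset order_trans)
qed

subsection \<open>Test functions and the fundamental lemma\<close>

lemma test_fun_smooth: "test_fun \<Omega> \<phi> \<Longrightarrow> smooth_fun \<phi>"
  by (simp add: test_fun_def)

lemma test_fun_differentiable: "test_fun \<Omega> \<phi> \<Longrightarrow> \<phi> differentiable (at x)"
  by (simp add: test_fun_smooth smooth_fun_differentiable)

lemma test_fun_continuous: "test_fun \<Omega> \<phi> \<Longrightarrow> continuous_on A \<phi>"
  by (meson test_fun_differentiable differentiable_imp_continuous_within continuous_at_imp_continuous_on)

lemma test_fun_borel: "test_fun \<Omega> \<phi> \<Longrightarrow> \<phi> \<in> borel_measurable borel"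
  by (simp add: borel_measurable_continuous_onI test_fun_continuous)

lemma eq_0_outside_support: "x \<notin> closure {x. g x \<noteq> 0} \<Longrightarrow> g x = 0"
  by (metis (mono_tags, lifting) closure_subset mem_Collect_eq subsetD)

lemma test_fun_eq_0: "test_fun \<Omega> \<phi> \<Longrightarrow> x \<notin> \<Omega> \<Longrightarrow> \<phi> x = 0"
  by (metis eq_0_outside_support subsetD test_fun_def)

text \<open>Vanishing is asked only off the closed support, because a derivative may be nonzero at
  points where the function itself is zero.\<close>

lemma test_funI:
  assumes "smooth_fun \<psi>" "test_fun \<Omega> \<phi>" "\<And>x. x \<notin> closure {x. \<phi> x \<noteq> 0} \<Longrightarrow> \<psi> x = 0"
  shows "test_fun \<Omega> \<psi>"
proof -
  have "closure {x. \<psi> x \<noteq> 0} \<subseteq> closure {x. \<phi> x \<noteq> 0}"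
    by (rule closure_minimal) (use assms(3) in auto)
  then show ?thesis
    using assms(1,2) unfolding test_fun_def
    by (meson closed_closure compact_closure bounded_subset closure_subset compact_imp_bounded order_trans)
qed

lemma test_fun_partial:
  assumes "test_fun \<Omega> \<phi>"
  shows "test_fun \<Omega> (partial j \<phi>)"
proof (rule test_funI[OF smooth_fun_partial[OF test_fun_smooth[OF assms]] assms])
  fix x assume x: "x \<notin> closure {x. \<phi> x \<noteq> 0}"
  have "(\<phi> has_derivative (\<lambda>_. 0)) (at x)"
  proof (rule has_derivative_transform_within_open[OF has_derivative_const])
    show "open (- closure {x. \<phi> x \<noteq> 0})" by (rule open_Compl) (rule closed_closure)
    show "x \<in> - closure {x. \<phi> x \<noteq> 0}" using x by blast
    show "0 = \<phi> y" if "y \<in> - closure {x. \<phi> x \<noteq> 0}" for y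
      using that by (intro eq_0_outside_support[symmetric]) (rule ComplD)
  qed
  then show "partial j \<phi> x = 0"
    by (rule partial_eqI)
qed

lemma test_fun_mult:
  assumes "test_fun \<Omega> \<phi>" "test_fun \<Omega> \<psi>"
  shows "test_fun \<Omega> (\<lambda>x. \<phi> x * \<psi> x)"
proof (rule test_funI[OF _ assms(1)])
  show "smooth_fun (\<lambda>x. \<phi> x * \<psi> x)"
    using assms test_fun_smooth by (blast intro: smooth_alg_imp_smooth_fun smooth_alg.mult smooth_alg.base)
next
  fix x assume "x \<notin> closure {x. \<phi> x \<noteq> 0}"
  then have "\<phi> x = 0" by (rule eq_0_outside_support)
  then show "\<phi> x * \<psi> x = 0" by simp
qed

lemma test_fun_bounded:
  assumes "test_fun \<Omega> \<phi>"
  obtains B where "B \<ge> 0" "\<And>x. \<bar>\<phi> x\<bar> \<le> B"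
proof -
  have "compact (\<phi> ` closure {x. \<phi> x \<noteq> 0})"
    using assms test_fun_continuous[OF assms] by (auto simp: test_fun_def intro: compact_continuous_image)
  then obtain B where B: "B > 0" "\<And>y. y \<in> \<phi> ` closure {x. \<phi> x \<noteq> 0} \<Longrightarrow> norm y \<le> B"
    using compact_imp_bounded bounded_pos by metis
  have "\<bar>\<phi> x\<bar> \<le> B" for x
    using B closure_subset[of "{x. \<phi> x \<noteq> 0}"] by (cases "\<phi> x = 0") (auto 0 3)
  with B that show ?thesis by (meson less_imp_le)
qed

lemma test_fun_integrable:
  assumes "test_fun \<Omega> \<phi>"
  shows "integrable lborel \<phi>"
proof -
  have "integrable lborel (\<lambda>x. indicator (closure {x. \<phi> x \<noteq> 0}) x *\<^sub>R \<phi> x)"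
    using borel_integrable_compact[OF _ test_fun_continuous[OF assms]] assms
    by (simp add: test_fun_def)
  moreover have "indicator (closure {x. \<phi> x \<noteq> 0}) x *\<^sub>R \<phi> x = \<phi> x" for x
    using eq_0_outside_support[of x \<phi>] by (auto simp: indicator_def)
  ultimately show ?thesis by (simp only:)
qed

section \<open>Integration by parts for test functions\<close>

lemma DERIV_along_axis:
  assumes "\<And>x. f differentiable (at x)"
  shows "((\<lambda>s. f (x + s *\<^sub>R axis j 1)) has_real_derivative partial j f (x + t *\<^sub>R axis j 1)) (at t)"
proof -
  let ?y = "x + t *\<^sub>R axis j 1"
  have d: "(f has_derivative frechet_derivative f (at ?y)) (at ?y)"
    using assms by (rule has_derivative_frechet)
  have "((\<lambda>s. x + s *\<^sub>R axis j 1) has_derivative (\<lambda>s. s *\<^sub>R axis j 1)) (at t)"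
    by (auto intro!: derivative_eq_intros)
  from has_derivative_compose[OF this d]
  have "((\<lambda>s. f (x + s *\<^sub>R axis j 1)) has_derivative (\<lambda>s. s * partial j f ?y)) (at t)"
    using linear_scale[OF has_derivative_linear[OF d]] by (simp add: partial_def)
  then show ?thesis
    by (simp add: has_field_derivative_def mult_commute_abs)
qed

text \<open>Translation invariance makes the integral of every difference quotient vanish.\<close>

lemma integral_partial_test_fun:
  assumes "test_fun \<Omega> \<psi>"
  shows "(\<integral>x. partial j \<psi> x \<partial>lborel) = 0"
proof -
  let ?e = "axis j 1 :: point"
  \<comment> \<open>Step sizes of at most 1 keep all difference quotients supported in one ball, of
    radius \<open>R + 1\<close>. With the mean value bound \<open>B\<close> this gives a single
    integrable majorant.\<close>
  define h where "h n = inverse (real (Suc n))" for n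
  have h: "0 < h n" "h n \<le> 1" for n
    by (auto simp: h_def inverse_le_1_iff)
  define q where "q n x = (\<psi> (x + h n *\<^sub>R ?e) - \<psi> x) / h n" for n x
  note diff = test_fun_differentiable[OF assms]
  obtain B where B: "B \<ge> 0" "\<And>x. \<bar>partial j \<psi> x\<bar> \<le> B"
    using test_fun_bounded[OF test_fun_partial[OF assms]] by metis
  have "compact (closure {x. \<psi> x \<noteq> 0})"
    using assms unfolding test_fun_def by blast
  then have "bounded {x. \<psi> x \<noteq> 0}"
    by (rule bounded_subset[OF compact_imp_bounded closure_subset])
  then obtain R where "\<forall>x\<in>{x. \<psi> x \<noteq> 0}. norm x \<le> R"
    unfolding bounded_iff by blast
  then have R: "\<psi> x = 0" if "norm x > R" for x
    using that by (meson mem_Collect_eq not_less)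
  have qB: "\<bar>q n x\<bar> \<le> B" for n x
  proof -
    have "\<exists>z. 0 < z \<and> z < h n \<and>
        \<psi> (x + h n *\<^sub>R ?e) - \<psi> (x + 0 *\<^sub>R ?e) = (h n - 0) * partial j \<psi> (x + z *\<^sub>R ?e)"
      by (rule MVT2[OF h(1)]) (rule DERIV_along_axis[OF diff])
    then obtain z where "\<psi> (x + h n *\<^sub>R ?e) - \<psi> x = h n * partial j \<psi> (x + z *\<^sub>R ?e)"
      by auto
    then have "q n x = partial j \<psi> (x + z *\<^sub>R ?e)"
      using h(1)[of n] by (simp add: q_def)
    then show ?thesis
      using B(2) by simp
  qed
  have qS: "q n x = 0" if "x \<notin> cball 0 (R + 1)" for n x
  proof -
    have x: "norm x > R + 1" using that by simp
    have "norm x \<le> norm (x + h n *\<^sub>R ?e) + norm (h n *\<^sub>R ?e)"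
      by (metis norm_triangle_ineq4 add_diff_cancel_right')
    then have "norm (x + h n *\<^sub>R ?e) > R"
      using x h(1)[of n] h(2)[of n] by (simp add: norm_axis_1)
    then have "\<psi> (x + h n *\<^sub>R ?e) = 0" "\<psi> x = 0"
      using R x by auto
    then show ?thesis by (simp add: q_def)
  qed
  have meas[measurable]: "\<psi> \<in> borel_measurable borel" "partial j \<psi> \<in> borel_measurable borel"
    using test_fun_borel test_fun_partial assms by blast+
  have lim: "(\<lambda>n. q n x) \<longlonglongrightarrow> partial j \<psi> x" for x
  proof -
    have "((\<lambda>s. (\<psi> (x + s *\<^sub>R ?e) - \<psi> x) / s) \<longlongrightarrow> partial j \<psi> x) (at 0)"
      using DERIV_along_axis[OF diff, of x j 0] by (simp add: has_field_derivative_iff)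
    moreover have "filterlim h (at 0) sequentially"
      using LIMSEQ_inverse_real_of_nat unfolding filterlim_at h_def by simp
    ultimately show ?thesis
      unfolding q_def by (rule filterlim_compose)
  qed
  have "(\<lambda>n. \<integral>x. q n x \<partial>lborel) \<longlonglongrightarrow> (\<integral>x. partial j \<psi> x \<partial>lborel)"
  proof (rule integral_dominated_convergence)
    show "integrable lborel (\<lambda>x. indicator (cball 0 (R + 1)) x *\<^sub>R B :: real)"
      by (rule borel_integrable_compact) auto
    show "AE x in lborel. norm (q n x) \<le> indicator (cball 0 (R + 1)) x *\<^sub>R B" for n
      using qB qS B(1) by (auto simp: indicator_def)
  qed (use lim in \<open>auto simp: q_def\<close>)
  moreover have "(\<integral>x. q n x \<partial>lborel) = 0" for n
  proof -
    have i: "integrable (distr lborel borel ((+) (h n *\<^sub>R ?e))) \<psi>"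
      using test_fun_integrable[OF assms] by (simp add: lborel_distr_plus)
    have "integrable lborel (\<lambda>x. \<psi> (h n *\<^sub>R ?e + x))"
      using integrable_distr[OF _ i] by simp
    moreover have "(\<integral>x. \<psi> (h n *\<^sub>R ?e + x) \<partial>lborel) = (\<integral>x. \<psi> x \<partial>lborel)"
      using integral_distr[of "(+) (h n *\<^sub>R ?e)" lborel borel \<psi>] by (simp add: lborel_distr_plus)
    ultimately show ?thesis
      using test_fun_integrable[OF assms] by (simp add: q_def add.commute)
  qed
  ultimately show ?thesis
    by (simp add: LIMSEQ_const_iff)
qed

text \<open>Transfers integrals over the domain to \<open>lborel\<close>, where translation
  invariance is available.\<close>

lemma integral_lebesgue_on_eq_lborel:
  fixes F :: "'a::euclidean_space \<Rightarrow> real"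
  assumes "open \<Omega>" "F \<in> borel_measurable borel" "\<And>x. x \<notin> \<Omega> \<Longrightarrow> F x = 0"
  shows "(\<integral>x. F x \<partial>(lebesgue_on \<Omega>)) = (\<integral>x. F x \<partial>lborel)"
proof -
  have "(\<integral>x. F x \<partial>(lebesgue_on \<Omega>)) = (\<integral>x. indicator \<Omega> x *\<^sub>R F x \<partial>lebesgue)"
    using assms(1) by (intro integral_restrict_space) auto
  also have "(\<lambda>x. indicator \<Omega> x *\<^sub>R F x) = F"
    using assms(3) by (auto simp: indicator_def fun_eq_iff)
  also have "integral\<^sup>L lebesgue F = integral\<^sup>L lborel F"
    using assms(2) by (intro integral_completion) auto
  finally show ?thesis .
qed

lemma integrable_lebesgue_on_test_fun:
  assumes "open \<Omega>" "test_fun \<Omega> \<phi>"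
  shows "integrable (lebesgue_on \<Omega>) \<phi>"
proof -
  have "integrable lebesgue \<phi>"
    using test_fun_integrable[OF assms(2)] test_fun_borel[OF assms(2)] by (simp add: integrable_completion)
  moreover have "(\<lambda>x. indicator \<Omega> x *\<^sub>R \<phi> x) = \<phi>"
    using test_fun_eq_0[OF assms(2)] by (auto simp: indicator_def fun_eq_iff)
  ultimately show ?thesis
    using assms(1) by (subst integrable_restrict_space) auto
qed

text \<open>The product of two test functions is a test function, so its partial derivative
  integrates to 0; the product rule then gives the identity.\<close>

lemma test_fun_has_weak_grad_scalar:
  assumes \<Omega>: "open \<Omega>" and \<phi>: "test_fun \<Omega> \<phi>"
  shows "has_weak_grad_scalar \<Omega> \<phi> (grad_test \<phi>)"
  unfolding has_weak_grad_scalar_def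
proof (intro allI impI)
  fix \<eta> j assume \<eta>: "test_fun \<Omega> \<eta>"
  note int = integrable_lebesgue_on_test_fun[OF \<Omega> test_fun_mult]
  have "(\<integral>x. partial j (\<lambda>x. \<phi> x * \<eta> x) x \<partial>(lebesgue_on \<Omega>)) = 0"
    using test_fun_partial[OF test_fun_mult[OF \<phi> \<eta>]]
      integral_partial_test_fun[OF test_fun_mult[OF \<phi> \<eta>]]
    by (subst integral_lebesgue_on_eq_lborel) (auto intro: \<Omega> test_fun_borel test_fun_eq_0)
  moreover have "partial j (\<lambda>x. \<phi> x * \<eta> x) x = partial j \<phi> x * \<eta> x + \<phi> x * partial j \<eta> x" for x
    using \<phi> \<eta> test_fun_differentiable by (blast intro: partial_mult)
  ultimately show "(\<integral>x. \<phi> x * partial j \<eta> x \<partial>(lebesgue_on \<Omega>))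
      = - (\<integral>x. grad_test \<phi> x $ j * \<eta> x \<partial>(lebesgue_on \<Omega>))"
    using int[OF test_fun_partial[OF \<phi>] \<eta>] int[OF \<phi> test_fun_partial[OF \<eta>]]
    by (simp add: grad_test_def)
qed

section \<open>The fundamental lemma of the calculus of variations\<close>

text \<open>Open boxes form an intersection-stable generator of the Borel sets, so Dynkin's argument
  extends the vanishing to all Borel sets; equal set integrals then force equality almost
  everywhere.\<close>

lemma AE_zero_if_box_integrals_zero:
  fixes h :: "'a::euclidean_space \<Rightarrow> real"
  assumes h: "integrable lborel h" and box: "\<And>a b. (\<integral>x\<in>box a b. h x \<partial>lborel) = 0"
  shows "AE x in lborel. h x = 0"
proof (rule density_unique_real[OF h])
  have si: "set_integrable lborel A h" if "A \<in> sets lborel" for A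
    using integrable_mult_indicator[OF that h] by (simp add: set_integrable_def)
  \<comment> \<open>The complement step of the Dynkin argument needs the integral over the whole
    space, obtained by exhausting it with growing boxes.\<close>
  let ?B = "\<lambda>n::nat. box (- (real n *\<^sub>R One)) (real n *\<^sub>R One) :: 'a set"
  have inc: "incseq ?B"
    by (rule incseq_SucI) (auto simp: mem_box inner_Basis, (smt (verit))+)
  have "(\<lambda>n. \<integral>x\<in>?B n. h x \<partial>lborel) \<longlonglongrightarrow> (\<integral>x\<in>(\<Union>n. ?B n). h x \<partial>lborel)"
    by (rule set_integral_cont_up[OF _ inc]) (auto intro: si)
  then have UNIV: "(\<integral>x\<in>UNIV. h x \<partial>lborel) = 0"
    using box by (simp add: UN_box_eq_UNIV LIMSEQ_const_iff)
  fix A assume "A \<in> sets (lborel :: 'a measure)"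
  then have A: "A \<in> sigma_sets UNIV (range (\<lambda>(a, b). box a b :: 'a set))"
    by (metis borel_eq_box sets_lborel sets_measure_of subset_UNIV Pow_UNIV)
  have st: "Int_stable (range (\<lambda>(a, b). box a b :: 'a set))"
    by (rule Int_stableI_image) (force simp: box_Int_box)
  have sub: "range (\<lambda>(a, b). box a b :: 'a set) \<subseteq> Pow UNIV" by simp
  \<comment> \<open>Measurability is carried along because additivity of the set integrals requires
    it of the sets in the induction hypotheses.\<close>
  have "A \<in> sets lborel \<and> (\<integral>x\<in>A. h x \<partial>lborel) = 0"
    using st sub A
  proof (induction rule: sigma_sets_induct_disjoint)
    case (basic A) then show ?case using box by auto
  next
    case empty show ?case by (simp add: set_lebesgue_integral_def)
  next
    case (compl A)
    have "(\<integral>x\<in>A \<union> (UNIV - A). h x \<partial>lborel) = (\<integral>x\<in>A. h x \<partial>lborel) + (\<integral>x\<in>UNIV - A. h x \<partial>lborel)"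
      using compl by (intro set_integral_Un si) auto
    then show ?case using compl UNIV by (auto simp: Compl_eq_Diff_UNIV[symmetric])
  next
    case (union A)
    have "(\<integral>x\<in>(\<Union>i. A i). h x \<partial>lborel) = (\<Sum>i. \<integral>x\<in>A i. h x \<partial>lborel)"
      using union by (intro lebesgue_integral_countable_add si) (auto simp: disjoint_family_on_def)
    then show ?case using union by auto
  qed
  then show "(\<integral>x\<in>A. h x \<partial>lborel) = (\<integral>x\<in>A. 0 \<partial>lborel)"
    by (simp add: set_lebesgue_integral_def)
qed simp

text \<open>Dominated convergence along the bumps of the box. The intermediate
  \<open>cbox c d\<close> ensures that the closure of a nonempty box stays inside \<Omega>, as the
  bumps need in order to be test functions.\<close>

lemma box_integral_eq_0:
  assumes g: "integrable (lebesgue_on \<Omega>) g"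
    and 0: "\<And>\<phi>. test_fun \<Omega> \<phi> \<Longrightarrow> (\<integral>x. g x * \<phi> x \<partial>(lebesgue_on \<Omega>)) = 0"
    and ab: "box a b \<subseteq> cbox c d" "cbox c d \<subseteq> \<Omega>"
  shows "(\<integral>x. g x * indicator (box a b) x \<partial>(lebesgue_on \<Omega>)) = 0"
proof (cases "box a b = {}")
  case False
  then have sub: "cbox a b \<subseteq> \<Omega>"
    using ab closure_minimal[OF ab(1) closed_cbox] by (simp add: closure_box)
  have meas: "box_bump a b n \<in> borel_measurable (lebesgue_on \<Omega>)" for n
    using test_fun_borel[OF test_fun_box_bump[OF order_refl]]
    by (intro measurable_restrict_space1 measurable_completion) simp
  have "(\<lambda>n. \<integral>x. g x * box_bump a b n x \<partial>(lebesgue_on \<Omega>)) \<longlonglongrightarrow>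
      (\<integral>x. g x * indicator (box a b) x \<partial>(lebesgue_on \<Omega>))"
  proof (rule integral_dominated_convergence)
    show "integrable (lebesgue_on \<Omega>) (\<lambda>x. norm (g x))" using g by simp
    show "AE x in lebesgue_on \<Omega>. norm (g x * box_bump a b n x) \<le> norm (g x)" for n
      using abs_box_bump_le[of a b n] by (auto simp: abs_mult intro!: mult_right_le_one_le)
    show "AE x in lebesgue_on \<Omega>. (\<lambda>n. g x * box_bump a b n x) \<longlonglongrightarrow> g x * indicator (box a b) x"
      by (intro AE_I2 tendsto_intros box_bump_tendsto)
    have "indicator (box a b) \<in> borel_measurable (lebesgue_on \<Omega>)"
      by (intro measurable_restrict_space1 measurable_completion) simp
    then show "(\<lambda>x. g x * indicator (box a b) x) \<in> borel_measurable (lebesgue_on \<Omega>)"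
      using g by (intro borel_measurable_times) auto
    show "(\<lambda>x. g x * box_bump a b n x) \<in> borel_measurable (lebesgue_on \<Omega>)" for n
      using g meas by (intro borel_measurable_times) auto
  qed
  then show ?thesis
    using 0[OF test_fun_box_bump[OF sub]] by (simp add: LIMSEQ_const_iff)
qed simp

text \<open>Bumps reach only boxes whose closure lies in \<Omega>. The claim is therefore proved on
  each closed box in \<Omega>, up to its null boundary, and then on \<Omega> as a countable union of
  such boxes.\<close>

lemma fundamental_lemma_variations:
  assumes \<Omega>: "open \<Omega>" and g: "integrable (lebesgue_on \<Omega>) g"
    and 0: "\<And>\<phi>. test_fun \<Omega> \<phi> \<Longrightarrow> (\<integral>x. g x * \<phi> x \<partial>(lebesgue_on \<Omega>)) = 0"
  shows "AE x in lebesgue_on \<Omega>. g x = 0"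
proof -
  define G where "G x = indicator \<Omega> x *\<^sub>R g x" for x
  have G: "integrable lebesgue G"
    using g \<Omega> unfolding G_def by (subst (asm) integrable_restrict_space) auto
  \<comment> \<open>A Borel representative is needed because the box criterion is stated over
    \<open>lborel\<close>, whereas \<open>G\<close> is only Lebesgue measurable.\<close>
  then obtain g' where g'[measurable]: "g' \<in> borel_measurable lborel" and G': "AE x in lborel. G x = g' x"
    using completion_ex_borel_measurable_real[OF borel_measurable_integrable] by blast
  have g'i: "integrable lborel g'"
  proof -
    have "integrable lebesgue g'"
      by (rule integrable_cong_AE_imp[OF G]) (use AE_completion[OF G'] measurable_completion[OF g'] in auto)
    then show ?thesis using g' by (simp add: integrable_completion)
  qed
  have cb: "AE x in lebesgue. x \<in> cbox c d \<longrightarrow> G x = 0" if cd: "cbox c d \<subseteq> \<Omega>" for c d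
  proof -
    have "AE x in lborel. indicator (box c d) x *\<^sub>R g' x = 0"
    proof (rule AE_zero_if_box_integrals_zero)
      show "integrable lborel (\<lambda>x. indicator (box c d) x *\<^sub>R g' x)"
        using integrable_mult_indicator[OF _ g'i] by simp
      fix a b :: point
      \<comment> \<open>Restricting \<open>g'\<close> to \<open>box c d\<close> turns an arbitrary
        test box into an intersection of two boxes, which is again a box and lies in
        \<open>cbox c d\<close>.\<close>
      obtain p q where pq: "box a b \<inter> box c d = box p q"
        using box_Int_box by blast
      have "(\<integral>x\<in>box a b. indicator (box c d) x *\<^sub>R g' x \<partial>lborel) = (\<integral>x. indicator (box p q) x *\<^sub>R g' x \<partial>lborel)"
        by (simp add: set_lebesgue_integral_def pq[symmetric] indicator_inter_arith mult.assoc)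
      also have "\<dots> = (\<integral>x. indicator (box p q) x *\<^sub>R g' x \<partial>lebesgue)"
        by (rule integral_completion[symmetric]) simp
      also have "\<dots> = (\<integral>x. indicator \<Omega> x *\<^sub>R (g x * indicator (box p q) x) \<partial>lebesgue)"
      proof (rule integral_cong_AE)
        show "AE x in lebesgue. indicator (box p q) x *\<^sub>R g' x = indicator \<Omega> x *\<^sub>R (g x * indicator (box p q) x)"
          using AE_completion[OF G'] by eventually_elim (auto simp: G_def)
        show "(\<lambda>x. indicator \<Omega> x *\<^sub>R (g x * indicator (box p q) x)) \<in> borel_measurable lebesgue"
        proof -
          have "(\<lambda>x. indicator (box p q) x *\<^sub>R G x) \<in> borel_measurable lebesgue"
            using integrable_mult_indicator[OF _ G, of "box p q"] by auto
          then show ?thesis by (simp add: G_def mult_ac)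
        qed
        show "(\<lambda>x. indicator (box p q) x *\<^sub>R g' x) \<in> borel_measurable lebesgue"
          by (rule measurable_completion) simp
      qed
      also have "\<dots> = (\<integral>x. g x * indicator (box p q) x \<partial>(lebesgue_on \<Omega>))"
        using \<Omega> by (intro integral_restrict_space[symmetric]) auto
      also have "\<dots> = 0"
        by (rule box_integral_eq_0[OF g 0 _ cd]) (use pq box_subset_cbox in auto)
      finally show "(\<integral>x\<in>box a b. indicator (box c d) x *\<^sub>R g' x \<partial>lborel) = 0" .
    qed
    then have "AE x in lebesgue. indicator (box c d) x *\<^sub>R g' x = 0" by (rule AE_completion)
    moreover have "AE x in lebesgue. x \<notin> cbox c d - box c d"
      using negligible_frontier_interval[of c d] negligible_iff_null_sets AE_not_in by blast
    ultimately show ?thesis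
      using AE_completion[OF G'] by eventually_elim auto
  qed
  obtain D where D: "countable D" "D \<subseteq> Pow \<Omega>" "\<And>X. X \<in> D \<Longrightarrow> \<exists>a b. X = cbox a b" "\<Union>D = \<Omega>"
    using open_countable_Union_open_cbox[OF \<Omega>] by metis
  have "AE x in lebesgue. \<forall>X\<in>D. x \<in> X \<longrightarrow> G x = 0"
  proof (subst AE_ball_countable[OF D(1)], intro ballI)
    fix X assume "X \<in> D"
    then obtain c d where "X = cbox c d" "cbox c d \<subseteq> \<Omega>"
      using D(2) D(3)[of X] by auto
    then show "AE x in lebesgue. x \<in> X \<longrightarrow> G x = 0"
      using cb[of c d] by simp
  qed
  then have "AE x in lebesgue. x \<in> \<Omega> \<longrightarrow> g x = 0"
  proof eventually_elim
    case (elim x)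
    then have "x \<in> \<Omega> \<longrightarrow> G x = 0" using D(4) by blast
    then show ?case by (auto simp: G_def)
  qed
  then show ?thesis
    using \<Omega> by (subst AE_restrict_space_iff) auto
qed

subsection \<open>Weak gradients\<close>

lemma test_fun_add:
  assumes "test_fun \<Omega> \<phi>" "test_fun \<Omega> \<psi>"
  shows "test_fun \<Omega> (\<lambda>x. \<phi> x + \<psi> x)"
proof -
  have "closure {x. \<phi> x + \<psi> x \<noteq> 0} \<subseteq> closure ({x. \<phi> x \<noteq> 0} \<union> {x. \<psi> x \<noteq> 0})"
    by (rule closure_mono) auto
  then have sub: "closure {x. \<phi> x + \<psi> x \<noteq> 0} \<subseteq> closure {x. \<phi> x \<noteq> 0} \<union> closure {x. \<psi> x \<noteq> 0}"
    by (simp only: closure_Un)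
  have "compact (closure {x. \<phi> x \<noteq> 0} \<union> closure {x. \<psi> x \<noteq> 0})"
    using assms unfolding test_fun_def by (blast intro: compact_Un)
  then have "compact (closure {x. \<phi> x + \<psi> x \<noteq> 0})"
    using sub by (meson bounded_subset closed_closure compact_eq_bounded_closed)
  moreover have "smooth_fun (\<lambda>x. \<phi> x + \<psi> x)"
    using assms test_fun_smooth by (blast intro: smooth_alg_imp_smooth_fun smooth_alg.add smooth_alg.base)
  ultimately show ?thesis
    using assms sub unfolding test_fun_def by blast
qed

text \<open>Rows are the gradients of the components, so \<open>field_grad \<phi> x *v w\<close> is
  the derivative of \<phi> along w, that is, (w . grad) \<phi>.\<close>

definition field_grad :: "field \<Rightarrow> point \<Rightarrow> real^3^3" where
  "field_grad \<phi> x = (\<chi> i. grad_test (\<lambda>x. \<phi> x $ i) x)"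

lemma norm_matrix_vector_mult_le:
  fixes A :: "real^'n^'m"
  shows "norm (A *v x) \<le> norm A * norm x"
proof -
  have "norm (A *v x) \<le> L2_set (\<lambda>i. norm (A $ i) * norm x) UNIV"
    unfolding norm_vec_def[of "A *v x"]
    by (rule L2_set_mono) (auto simp: matrix_vector_mul_component Cauchy_Schwarz_ineq2)
  also have "\<dots> = norm A * norm x"
    by (simp add: L2_set_left_distrib norm_vec_def)
  finally show ?thesis .
qed

section \<open>Square-integrable fields and the Cauchy-Schwarz inequality\<close>

lemma L2_measurable: "L2 \<Omega> f \<Longrightarrow> f \<in> borel_measurable (lebesgue_on \<Omega>)"
  by (simp add: L2_def)

lemma L2_integrable_sq: "L2 \<Omega> f \<Longrightarrow> integrable (lebesgue_on \<Omega>) (\<lambda>x. (norm (f x))\<^sup>2)"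
  by (simp add: L2_def)

lemma L2_norm_sq: "(L2_norm \<Omega> f)\<^sup>2 = (\<integral>x. (norm (f x))\<^sup>2 \<partial>(lebesgue_on \<Omega>))"
  by (simp add: L2_norm_def)

lemma L2_norm_nonneg: "0 \<le> L2_norm \<Omega> f"
  by (simp add: L2_norm_def)

lemma L2_integrable_norm_mult:
  assumes "L2 \<Omega> f" "L2 \<Omega> g"
  shows "integrable (lebesgue_on \<Omega>) (\<lambda>x. norm (f x) * norm (g x))"
proof (rule Bochner_Integration.integrable_bound)
  show "integrable (lebesgue_on \<Omega>) (\<lambda>x. (norm (f x))\<^sup>2 + (norm (g x))\<^sup>2)"
    using assms by (intro Bochner_Integration.integrable_add L2_integrable_sq)
  show "(\<lambda>x. norm (f x) * norm (g x)) \<in> borel_measurable (lebesgue_on \<Omega>)"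
    using assms[THEN L2_measurable] by measurable
  have "\<bar>a * b\<bar> \<le> \<bar>a\<^sup>2 + b\<^sup>2\<bar>" if "0 \<le> a" "0 \<le> b" for a b :: real
  proof -
    have "2 * (a * b) \<le> a\<^sup>2 + b\<^sup>2" "0 \<le> a * b"
      using that sum_squares_bound[of a b] by (simp_all add: mult.assoc)
    then show ?thesis by linarith
  qed
  then show "AE x in lebesgue_on \<Omega>. norm (norm (f x) * norm (g x)) \<le> norm ((norm (f x))\<^sup>2 + (norm (g x))\<^sup>2)"
    by simp
qed

lemma L2_integrable_inner:
  assumes "L2 \<Omega> f" "L2 \<Omega> g"
  shows "integrable (lebesgue_on \<Omega>) (\<lambda>x. f x \<bullet> g x)"
  by (rule Bochner_Integration.integrable_bound[OF L2_integrable_norm_mult[OF assms]])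
    (use assms[THEN L2_measurable] in \<open>auto simp: Cauchy_Schwarz_ineq2\<close>)

lemma L2_add:
  assumes "L2 \<Omega> f" "L2 \<Omega> g"
  shows "L2 \<Omega> (\<lambda>x. f x + g x)"
proof -
  have "integrable (lebesgue_on \<Omega>) (\<lambda>x. (norm (f x))\<^sup>2 + 2 * (f x \<bullet> g x) + (norm (g x))\<^sup>2)"
    using assms
    by (intro Bochner_Integration.integrable_add integrable_mult_right L2_integrable_sq L2_integrable_inner)
  moreover have "(norm (f x))\<^sup>2 + 2 * (f x \<bullet> g x) + (norm (g x))\<^sup>2 = (norm (f x + g x))\<^sup>2" for x
    by (simp add: power2_norm_eq_inner inner_simps inner_commute)
  ultimately show ?thesis
    using assms[THEN L2_measurable] by (simp add: L2_def)
qed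

lemma L2_scaleR: "L2 \<Omega> f \<Longrightarrow> L2 \<Omega> (\<lambda>x. c *\<^sub>R f x)"
  by (auto simp: L2_def power_mult_distrib)

lemma L2_diff: "L2 \<Omega> f \<Longrightarrow> L2 \<Omega> g \<Longrightarrow> L2 \<Omega> (\<lambda>x. f x - g x)"
  using L2_add[OF _ L2_scaleR[of \<Omega> g "-1"]] by simp

lemma L2_vec_nth:
  fixes f :: "point \<Rightarrow> 'a::euclidean_space ^ 'n"
  assumes "L2 \<Omega> f"
  shows "L2 \<Omega> (\<lambda>x. f x $ i)"
proof -
  have meas: "(\<lambda>x. f x $ i) \<in> borel_measurable (lebesgue_on \<Omega>)"
    by (rule measurable_compose[OF L2_measurable[OF assms]])
      (intro borel_measurable_continuous_onI continuous_intros)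
  have "integrable (lebesgue_on \<Omega>) (\<lambda>x. (norm (f x $ i))\<^sup>2)"
    by (rule Bochner_Integration.integrable_bound[OF L2_integrable_sq[OF assms]])
      (use meas in \<open>auto simp: Finite_Cartesian_Product.norm_nth_le power_mono\<close>)
  with meas show ?thesis by (simp add: L2_def)
qed

text \<open>Discriminant argument: for P > 0 the choice t = R / P is optimal; for P = 0 the right
  side is constant in t, so R must vanish.\<close>

lemma power2_le_mult_if_quadratic:
  fixes P Q R :: real
  assumes quad: "\<And>t. 2 * t * R \<le> t\<^sup>2 * P + Q" and "0 \<le> P"
  shows "R\<^sup>2 \<le> P * Q"
proof (cases "P = 0")
  case True
  have "R = 0"
  proof (rule ccontr)
    assume "R \<noteq> 0"
    \<comment> \<open>This t makes the left side \<open>Q + 1\<close>, while the right side is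
      \<open>Q\<close>.\<close>
    then show False using quad[of "(Q + 1) / (2 * R)"] True by simp
  qed
  then show ?thesis using True by simp
next
  case False
  then have P: "P > 0" using assms(2) by simp
  have "2 * (R\<^sup>2 / P) \<le> R\<^sup>2 / P + Q"
    using quad[of "R / P"] False by (simp add: power2_eq_square)
  then have "R\<^sup>2 / P \<le> Q" by simp
  then show ?thesis using P by (simp add: divide_le_eq mult.commute)
qed

text \<open>Integrating (t |f| - |g|)^2 \<ge> 0 gives the quadratic inequality in t. Having the
  norms inside the integral makes the result usable for matrix-vector products, not only for inner
  products.\<close>

lemma L2_Cauchy_Schwarz:
  assumes "L2 \<Omega> f" "L2 \<Omega> g"
  shows "(\<integral>x. norm (f x) * norm (g x) \<partial>(lebesgue_on \<Omega>)) \<le> L2_norm \<Omega> f * L2_norm \<Omega> g"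
proof -
  let ?R = "\<integral>x. norm (f x) * norm (g x) \<partial>(lebesgue_on \<Omega>)"
  let ?P = "(L2_norm \<Omega> f)\<^sup>2" and ?Q = "(L2_norm \<Omega> g)\<^sup>2"
  have quad: "2 * t * ?R \<le> t\<^sup>2 * ?P + ?Q" for t
  proof -
    have "2 * t * ?R = (\<integral>x. 2 * t * (norm (f x) * norm (g x)) \<partial>(lebesgue_on \<Omega>))"
      by simp
    also have "\<dots> \<le> (\<integral>x. t\<^sup>2 * (norm (f x))\<^sup>2 + (norm (g x))\<^sup>2 \<partial>(lebesgue_on \<Omega>))"
    proof (rule integral_mono)
      show "2 * t * (norm (f x) * norm (g x)) \<le> t\<^sup>2 * (norm (f x))\<^sup>2 + (norm (g x))\<^sup>2" for x
        using sum_squares_bound[of "t * norm (f x)" "norm (g x)"] by (simp add: power_mult_distrib mult_ac)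
    qed (use assms in \<open>auto intro!: L2_integrable_norm_mult L2_integrable_sq\<close>)
    also have "\<dots> = t\<^sup>2 * ?P + ?Q"
      using assms by (simp add: L2_norm_sq L2_integrable_sq)
    finally show ?thesis .
  qed
  have "?R\<^sup>2 \<le> ?P * ?Q"
    by (rule power2_le_mult_if_quadratic[OF quad]) simp
  then have "?R\<^sup>2 \<le> (L2_norm \<Omega> f * L2_norm \<Omega> g)\<^sup>2" by (simp add: power_mult_distrib)
  then show ?thesis using L2_norm_nonneg power2_le_imp_le by (metis mult_nonneg_nonneg)
qed

lemma L2_norm_cong_AE:
  assumes "AE x in lebesgue_on \<Omega>. f x = g x" "L2 \<Omega> f" "L2 \<Omega> g"
  shows "L2_norm \<Omega> f = L2_norm \<Omega> g"
proof -
  have "(\<integral>x. (norm (f x))\<^sup>2 \<partial>(lebesgue_on \<Omega>)) = (\<integral>x. (norm (g x))\<^sup>2 \<partial>(lebesgue_on \<Omega>))"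
    using assms by (intro integral_cong_AE) (auto simp: L2_def)
  then show ?thesis by (simp add: L2_norm_def)
qed

lemma test_fun_measurable: "test_fun \<Omega> \<phi> \<Longrightarrow> \<phi> \<in> borel_measurable (lebesgue_on \<Omega>)"
  using test_fun_borel by (intro measurable_restrict_space1 measurable_completion) simp

lemma integrable_mult_test_fun:
  fixes g :: "point \<Rightarrow> real"
  assumes "integrable (lebesgue_on \<Omega>) g" "test_fun \<Omega> \<phi>"
  shows "integrable (lebesgue_on \<Omega>) (\<lambda>x. g x * \<phi> x)"
proof -
  obtain B where B: "\<And>x. \<bar>\<phi> x\<bar> \<le> B"
    using test_fun_bounded[OF assms(2)] by metis
  show ?thesis
  proof (rule Bochner_Integration.integrable_bound)
    show "integrable (lebesgue_on \<Omega>) (\<lambda>x. B * norm (g x))" using assms(1) by simp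
    have "norm (g x * \<phi> x) \<le> norm (B * norm (g x))" for x
      using mult_mono[OF B[of x] order_refl, of "\<bar>g x\<bar>"] order_trans[OF abs_ge_zero B[of x]]
      by (simp add: abs_mult mult.commute)
    then show "AE x in lebesgue_on \<Omega>. norm (g x * \<phi> x) \<le> norm (B * norm (g x))" by simp
    show "(\<lambda>x. g x * \<phi> x) \<in> borel_measurable (lebesgue_on \<Omega>)"
      using assms test_fun_measurable by (intro borel_measurable_times) auto
  qed
qed

lemma L2_vecI:
  fixes f :: "point \<Rightarrow> 'a::euclidean_space ^ 'n"
  assumes "\<And>i. L2 \<Omega> (\<lambda>x. f x $ i)"
  shows "L2 \<Omega> f"
proof -
  have "(\<lambda>x. (f x $ i) \<bullet> b) \<in> borel_measurable (lebesgue_on \<Omega>)" for i b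
    using L2_measurable[OF assms[of i]] by measurable
  then have "f \<in> borel_measurable (lebesgue_on \<Omega>)"
    by (subst borel_measurable_euclidean_space) (auto simp: Basis_vec_def inner_axis)
  moreover have "(norm (f x))\<^sup>2 = (\<Sum>i\<in>UNIV. (norm (f x $ i))\<^sup>2)" for x
    by (simp add: norm_vec_def L2_set_def sum_nonneg)
  ultimately show ?thesis
    using assms[THEN L2_integrable_sq] by (simp add: L2_def)
qed

section \<open>Uniqueness of weak gradients and approximation by test fields\<close>

context
  fixes \<Omega> :: "point set"
  assumes \<Omega>: "open \<Omega>" "bounded \<Omega>"
begin

lemma finite_measure_\<Omega>: "finite_measure (lebesgue_on \<Omega>)"
  using \<Omega> bounded_set_imp_lmeasurable[of \<Omega>] finite_measure_lebesgue_on by auto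

text \<open>Boundedness of \<Omega> enters here: the measure is finite and |a| \<le> 1 + a^2. This
  puts weak gradients within reach of the fundamental lemma, which is stated for integrable
  functions.\<close>

lemma L2_integrable:
  fixes f :: "point \<Rightarrow> real"
  assumes "L2 \<Omega> f"
  shows "integrable (lebesgue_on \<Omega>) f"
proof (rule Bochner_Integration.integrable_bound)
  interpret finite_measure "lebesgue_on \<Omega>" by (rule finite_measure_\<Omega>)
  show "integrable (lebesgue_on \<Omega>) (\<lambda>x. 1 + (norm (f x))\<^sup>2)"
    using L2_integrable_sq[OF assms] by simp
  have "\<bar>a\<bar> \<le> \<bar>1 + a\<^sup>2\<bar>" for a :: real
    using sum_squares_bound[of 1 "\<bar>a\<bar>"] by simp
  then show "AE x in lebesgue_on \<Omega>. norm (f x) \<le> norm (1 + (norm (f x))\<^sup>2)" by simp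
qed (rule L2_measurable[OF assms])

lemma test_fun_L2:
  assumes "test_fun \<Omega> \<phi>"
  shows "L2 \<Omega> \<phi>"
  using integrable_lebesgue_on_test_fun[OF \<Omega>(1) test_fun_mult[OF assms assms]] test_fun_measurable[OF assms]
  by (simp add: L2_def power2_eq_square)

text \<open>Each component of the difference annihilates all test functions. Square integrability is
  what permits subtracting the two identities, since \<open>has_weak_grad_scalar\<close> asserts no
  integrability by itself.\<close>

lemma weak_grad_scalar_unique:
  assumes "has_weak_grad_scalar \<Omega> q g" "has_weak_grad_scalar \<Omega> q g'" "L2 \<Omega> g" "L2 \<Omega> g'"
  shows "AE x in lebesgue_on \<Omega>. g x = g' x"
proof -
  have int: "integrable (lebesgue_on \<Omega>) (\<lambda>x. g x $ j)" "integrable (lebesgue_on \<Omega>) (\<lambda>x. g' x $ j)" for j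
    using L2_integrable[OF L2_vec_nth[OF assms(3)]] L2_integrable[OF L2_vec_nth[OF assms(4)]] .
  have "AE x in lebesgue_on \<Omega>. g x $ j - g' x $ j = 0" for j
  proof (rule fundamental_lemma_variations[OF \<Omega>(1)])
    show "integrable (lebesgue_on \<Omega>) (\<lambda>x. g x $ j - g' x $ j)" using int by simp
    fix \<phi> assume \<phi>: "test_fun \<Omega> \<phi>"
    have "(\<integral>x. q x * partial j \<phi> x \<partial>(lebesgue_on \<Omega>)) = - (\<integral>x. g x $ j * \<phi> x \<partial>(lebesgue_on \<Omega>))"
      "(\<integral>x. q x * partial j \<phi> x \<partial>(lebesgue_on \<Omega>)) = - (\<integral>x. g' x $ j * \<phi> x \<partial>(lebesgue_on \<Omega>))"
      using assms(1,2) \<phi> unfolding has_weak_grad_scalar_def by blast+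
    then show "(\<integral>x. (g x $ j - g' x $ j) * \<phi> x \<partial>(lebesgue_on \<Omega>)) = 0"
      using integrable_mult_test_fun[OF int(1) \<phi>] integrable_mult_test_fun[OF int(2) \<phi>]
      by (simp add: left_diff_distrib)
  qed
  then have "AE x in lebesgue_on \<Omega>. \<forall>j\<in>UNIV. g x $ j - g' x $ j = 0"
    by (intro AE_finite_allI) auto
  then show ?thesis by eventually_elim (simp add: vec_eq_iff)
qed

lemma weak_grad_unique:
  assumes "has_weak_grad \<Omega> v G" "has_weak_grad \<Omega> v G'" "L2 \<Omega> G" "L2 \<Omega> G'"
  shows "AE x in lebesgue_on \<Omega>. G x = G' x"
proof -
  have "AE x in lebesgue_on \<Omega>. \<forall>i\<in>UNIV. G x $ i = G' x $ i"
    using assms unfolding has_weak_grad_def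
    by (intro AE_finite_allI weak_grad_scalar_unique) (auto intro: L2_vec_nth)
  then show ?thesis by eventually_elim (simp add: vec_eq_iff)
qed

lemma has_weak_grad_diff:
  assumes "has_weak_grad \<Omega> v G" "has_weak_grad \<Omega> v' G'"
    and "L2 \<Omega> v" "L2 \<Omega> v'" "L2 \<Omega> G" "L2 \<Omega> G'"
  shows "has_weak_grad \<Omega> (\<lambda>x. v x - v' x) (\<lambda>x. G x - G' x)"
  unfolding has_weak_grad_def has_weak_grad_scalar_def
proof (intro allI impI)
  fix i j \<phi> assume \<phi>: "test_fun \<Omega> \<phi>"
  have "integrable (lebesgue_on \<Omega>) (\<lambda>x. f x $ i * partial j \<phi> x)" if "L2 \<Omega> f" for f :: field
    using that L2_vec_nth L2_integrable integrable_mult_test_fun[OF _ test_fun_partial[OF \<phi>]] by blast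
  moreover have "integrable (lebesgue_on \<Omega>) (\<lambda>x. F x $ i $ j * \<phi> x)" if "L2 \<Omega> F" for F :: "point \<Rightarrow> real^3^3"
    using integrable_mult_test_fun[OF L2_integrable[OF L2_vec_nth[OF L2_vec_nth[OF that]]] \<phi>] .
  ultimately show "(\<integral>x. (v x - v' x) $ i * partial j \<phi> x \<partial>(lebesgue_on \<Omega>))
      = - (\<integral>x. (G x - G' x) $ i $ j * \<phi> x \<partial>(lebesgue_on \<Omega>))"
    using assms \<phi> unfolding has_weak_grad_def has_weak_grad_scalar_def
    by (simp add: left_diff_distrib)
qed

lemma test_field_L2:
  assumes "test_field \<Omega> \<phi>"
  shows "L2 \<Omega> \<phi>" "L2 \<Omega> (field_grad \<phi>)"
  using assms unfolding test_field_def
  by (auto intro!: L2_vecI test_fun_L2 test_fun_partial simp: field_grad_def grad_test_def)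

lemma test_field_has_weak_grad:
  "test_field \<Omega> \<phi> \<Longrightarrow> has_weak_grad \<Omega> \<phi> (field_grad \<phi>)"
  using test_fun_has_weak_grad_scalar[OF \<Omega>(1)]
  by (simp add: test_field_def has_weak_grad_def field_grad_def)

lemma H1_wgrad:
  assumes "H1 \<Omega> v"
  shows "has_weak_grad \<Omega> v (wgrad \<Omega> v)" "L2 \<Omega> (wgrad \<Omega> v)"
  using assms someI_ex[of "\<lambda>G. has_weak_grad \<Omega> v G \<and> L2 \<Omega> G"] by (auto simp: H1_def wgrad_def)

text \<open>\<open>H10\<close> measures the approximation by \<open>wgrad\<close> of the difference,
  a chosen object without evident linearity. Uniqueness replaces it by the classical gradient of the
  test field minus \<open>wgrad \<Omega> v\<close>, with equal norm.\<close>

lemma H10_approx: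
  assumes "H10 \<Omega> v"
  obtains \<phi> :: "nat \<Rightarrow> field" where "\<And>k. test_field \<Omega> (\<phi> k)"
    "(\<lambda>k. L2_norm \<Omega> (\<lambda>x. \<phi> k x - v x)) \<longlonglongrightarrow> 0"
    "(\<lambda>k. L2_norm \<Omega> (\<lambda>x. field_grad (\<phi> k) x - wgrad \<Omega> v x)) \<longlonglongrightarrow> 0"
proof -
  have v: "H1 \<Omega> v" "L2 \<Omega> v" using assms by (auto simp: H10_def H1_def)
  obtain \<phi> :: "nat \<Rightarrow> field" where \<phi>: "\<And>k. test_field \<Omega> (\<phi> k)"
    and lim: "(\<lambda>k. H1_norm \<Omega> (\<lambda>x. \<phi> k x - v x)) \<longlonglongrightarrow> 0"
    using assms unfolding H10_def by blast
  have "L2_norm \<Omega> (wgrad \<Omega> (\<lambda>x. \<phi> k x - v x)) = L2_norm \<Omega> (\<lambda>x. field_grad (\<phi> k) x - wgrad \<Omega> v x)" for k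
  proof -
    note p = test_field_L2[OF \<phi>[of k]] test_field_has_weak_grad[OF \<phi>[of k]] H1_wgrad[OF v(1)] v(2)
    have g: "has_weak_grad \<Omega> (\<lambda>x. \<phi> k x - v x) (\<lambda>x. field_grad (\<phi> k) x - wgrad \<Omega> v x)"
      "L2 \<Omega> (\<lambda>x. field_grad (\<phi> k) x - wgrad \<Omega> v x)"
      using p by (auto intro: has_weak_grad_diff L2_diff)
    then have "H1 \<Omega> (\<lambda>x. \<phi> k x - v x)"
      using p by (auto simp: H1_def intro: L2_diff)
    from weak_grad_unique[OF H1_wgrad(1)[OF this] g(1) H1_wgrad(2)[OF this] g(2)] H1_wgrad(2)[OF this] g(2)
    show ?thesis by (rule L2_norm_cong_AE)
  qed
  then have H1: "H1_norm \<Omega> (\<lambda>x. \<phi> k x - v x) =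
      sqrt ((L2_norm \<Omega> (\<lambda>x. \<phi> k x - v x))\<^sup>2 + (L2_norm \<Omega> (\<lambda>x. field_grad (\<phi> k) x - wgrad \<Omega> v x))\<^sup>2)" for k
    by (simp add: H1_norm_def)
  have "(\<lambda>k. L2_norm \<Omega> (\<lambda>x. \<phi> k x - v x)) \<longlonglongrightarrow> 0"
    by (rule tendsto_sandwich[OF _ _ tendsto_const lim]) (auto simp: H1 L2_norm_nonneg)
  moreover have "(\<lambda>k. L2_norm \<Omega> (\<lambda>x. field_grad (\<phi> k) x - wgrad \<Omega> v x)) \<longlonglongrightarrow> 0"
    by (rule tendsto_sandwich[OF _ _ tendsto_const lim]) (auto simp: H1 L2_norm_nonneg)
  ultimately show ?thesis using \<phi> that by blast
qed

end

subsection \<open>Vanishing of the convection term\<close>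

text \<open>The derivative of s / (1 + e s) with respect to s.\<close>

definition damping :: "real \<Rightarrow> real \<Rightarrow> real" where
  "damping e s = inverse ((1 + e * s)\<^sup>2)"

lemma damping_bounds:
  assumes "0 \<le> e" "0 \<le> s"
  shows "0 \<le> damping e s" "damping e s \<le> 1"
proof -
  have "1 \<le> (1 + e * s)\<^sup>2" using assms by simp
  then show "0 \<le> damping e s" "damping e s \<le> 1"
    by (auto simp: damping_def inverse_le_1_iff)
qed

text \<open>With n = |y|: n \<le> 1 + n^2 \<le> (1 + 1/e) (1 + e n^2), and the last factor is at
  least 1, hence at most its square. The constant is not optimal; what counts is that it does not
  depend on y.\<close>

lemma damping_mult_norm_le:
  fixes y :: "'a::real_normed_vector"
  assumes "e > 0"
  shows "norm (damping e ((norm y)\<^sup>2) *\<^sub>R y) \<le> 1 + inverse e"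
proof -
  let ?n = "norm y" and ?D = "1 + e * (norm y)\<^sup>2"
  have D: "1 \<le> ?D" using assms by simp
  have "2 * ?n \<le> 1 + ?n\<^sup>2"
    using sum_squares_bound[of 1 ?n] by simp
  then have "?n \<le> 1 + ?n\<^sup>2"
    using norm_ge_zero[of y] by linarith
  also have "\<dots> \<le> (1 + inverse e) * ?D"
    using assms by (simp add: field_simps)
  also have "\<dots> \<le> (1 + inverse e) * ?D\<^sup>2"
    using D assms self_le_power[OF D, of 2] by (intro mult_left_mono) auto
  finally have "inverse (?D\<^sup>2) * ?n \<le> 1 + inverse e"
    using D by (simp add: field_simps)
  then show ?thesis by (simp add: damping_def)
qed

lemma continuous_damping:
  assumes "e \<ge> 0"
  shows "continuous_on UNIV (\<lambda>y::'a::real_normed_vector. damping e ((norm y)\<^sup>2) *\<^sub>R y)"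
proof -
  have "1 + e * (norm y)\<^sup>2 \<noteq> 0" for y :: 'a
    using assms by (smt (verit) mult_nonneg_nonneg zero_le_power2)
  then show ?thesis
    unfolding damping_def by (intro continuous_intros) auto
qed

text \<open>The witness is s / (2 (1 + e s)) with s = |\<phi>|^2, whose gradient stays square integrable in the
  limit because damping e s \<phi> is bounded.\<close>

lemma damped_energy_test_fun:
  assumes e: "e \<ge> 0" and \<phi>: "test_field \<Omega> \<phi>"
  obtains \<psi> where "test_fun \<Omega> \<psi>"
    "\<And>x w. w \<bullet> grad_test \<psi> x = (field_grad \<phi> x *v w) \<bullet> (damping e ((norm (\<phi> x))\<^sup>2) *\<^sub>R \<phi> x)"
proof -
  define S where "S x = \<phi> x $ 1 * \<phi> x $ 1 + \<phi> x $ 2 * \<phi> x $ 2 + \<phi> x $ 3 * \<phi> x $ 3" for x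
  \<comment> \<open>The factor 1/2 cancels the 2 in the gradient of |\<phi>|^2.\<close>
  define \<psi> where "\<psi> x = S x * inverse (1 + e * S x) * (1 / 2)" for x
  have c: "test_fun \<Omega> (\<lambda>x. \<phi> x $ i)" for i
    using \<phi> by (simp add: test_field_def)
  have S: "test_fun \<Omega> S"
    unfolding S_def by (intro test_fun_add test_fun_mult c)
  have S_norm: "S x = (norm (\<phi> x))\<^sup>2" for x
    by (simp add: S_def power2_norm_eq_inner inner_vec_def sum_3)
  have pos: "1 + e * S x > 0" for x
    using e by (simp add: S_norm add_pos_nonneg)
  have "smooth_alg \<psi>"
    unfolding \<psi>_def
    by (intro smooth_alg.mult smooth_alg.inverse smooth_alg.add smooth_alg.const smooth_alg.base[OF test_fun_smooth[OF S]])
      (use pos in \<open>auto simp: less_imp_neq[THEN not_sym]\<close>)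
  then have "test_fun \<Omega> \<psi>"
  proof (intro test_funI[OF smooth_alg_imp_smooth_fun S])
    fix x assume "x \<notin> closure {x. S x \<noteq> 0}"
    then have "S x = 0" by (rule eq_0_outside_support)
    then show "\<psi> x = 0" by (simp add: \<psi>_def)
  qed
  moreover have "w \<bullet> grad_test \<psi> x = (field_grad \<phi> x *v w) \<bullet> (damping e ((norm (\<phi> x))\<^sup>2) *\<^sub>R \<phi> x)" for x w
  proof -
    note d = test_fun_differentiable[OF c] test_fun_differentiable[OF test_fun_mult[OF c c]]
      test_fun_differentiable[OF test_fun_add[OF test_fun_mult[OF c c] test_fun_mult[OF c c]]]
    have pS: "partial j S x = 2 * (\<Sum>i\<in>UNIV. \<phi> x $ i * partial j (\<lambda>x. \<phi> x $ i) x)" for j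
      unfolding S_def by (simp add: partial_add partial_mult d sum_3)
    have h: "((\<lambda>s. s * inverse (1 + e * s) * (1 / 2)) has_real_derivative (damping e (S x) / 2)) (at (S x))"
    proof -
      let ?q = "1 + e * S x"
      have q: "?q \<noteq> 0" using pos[of x] by simp
      have "((\<lambda>s. s * inverse (1 + e * s) * (1 / 2)) has_real_derivative
          (inverse ?q - e * S x * (inverse ?q * inverse ?q)) / 2) (at (S x))"
        using q by (auto intro!: derivative_eq_intros)
      \<comment> \<open>Applied with y = 1 + e s at s = \<open>S x\<close>, so that y - 1 = e
        s.\<close>
      moreover have "inverse y - (y - 1) * (inverse y * inverse y) = inverse (y\<^sup>2)" if "y \<noteq> 0" for y :: real
        using that by (simp add: field_simps power2_eq_square)
      from this[OF q] have "inverse ?q - e * S x * (inverse ?q * inverse ?q) = damping e (S x)"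
        by (simp add: damping_def)
      ultimately show ?thesis by (simp only:)
    qed
    have "partial j \<psi> x = damping e (S x) / 2 * partial j S x" for j
      unfolding \<psi>_def by (rule partial_comp(1)[OF test_fun_differentiable[OF S] h])
    then have "partial j \<psi> x = damping e (S x) * (\<Sum>i\<in>UNIV. \<phi> x $ i * partial j (\<lambda>x. \<phi> x $ i) x)" for j
      by (simp add: pS)
    then show ?thesis
      by (simp add: grad_test_def field_grad_def inner_vec_def matrix_vector_mult_def sum_3 S_norm algebra_simps)
  qed
  ultimately show ?thesis using that by blast
qed

context
  fixes \<Omega> :: "point set"
  assumes \<Omega>: "open \<Omega>" "bounded \<Omega>"
begin

text \<open>For a test field the integrand is w paired with a gradient of a test function, so its
  integral is 0. Passing from \<open>\<phi> k\<close> to \<open>v\<close> leaves two errors: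
  \<open>E k\<close> changes the values inside the bounded continuous map \<open>b\<close> and is
  treated by dominated convergence; \<open>F k\<close> changes the gradient and is treated by
  Cauchy-Schwarz together with the bound on \<open>b\<close>.\<close>

lemma damped_convection_eq_0:
  assumes v: "H10 \<Omega> v" and w: "L2 \<Omega> w" "weak_div_free \<Omega> w" and e: "e > 0"
  shows "(\<integral>x. (wgrad \<Omega> v x *v w x) \<bullet> (damping e ((norm (v x))\<^sup>2) *\<^sub>R v x) \<partial>(lebesgue_on \<Omega>)) = 0"
proof -
  let ?M = "lebesgue_on \<Omega>"
  define b :: "real^3 \<Rightarrow> real^3" where "b y = damping e ((norm y)\<^sup>2) *\<^sub>R y" for y
  define B where "B = 1 + inverse e"
  define G where "G = wgrad \<Omega> v"
  have B: "norm (b y) \<le> B" for y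
    unfolding b_def B_def by (rule damping_mult_norm_le[OF e])
  have B0: "B \<ge> 0" using e by (simp add: B_def)
  have b_cont: "continuous_on UNIV b"
    unfolding b_def using e by (intro continuous_damping) simp
  have v': "H1 \<Omega> v" "L2 \<Omega> v" using v by (auto simp: H10_def H1_def)
  have G: "L2 \<Omega> G" unfolding G_def by (rule H1_wgrad(2)[OF \<Omega> v'(1)])
  obtain \<phi> where \<phi>: "\<And>k::nat. test_field \<Omega> (\<phi> k)"
    and \<phi>0: "(\<lambda>k. L2_norm \<Omega> (\<lambda>x. \<phi> k x - v x)) \<longlonglongrightarrow> 0"
    and \<phi>1: "(\<lambda>k. L2_norm \<Omega> (\<lambda>x. field_grad (\<phi> k) x - G x)) \<longlonglongrightarrow> 0"
    by (rule H10_approx[OF \<Omega> v, folded G_def]) (rule that)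
  have \<phi>L2: "L2 \<Omega> (\<phi> k)" "L2 \<Omega> (field_grad (\<phi> k))" for k
    using test_field_L2[OF \<Omega> \<phi>] by auto
  \<comment> \<open>L^2 convergence gives pointwise convergence only along a subsequence.
    \<open>E\<close> needs this; \<open>F\<close> converges along the full sequence and is
    restricted to \<open>r\<close> at the end.\<close>
  have "\<exists>r::nat\<Rightarrow>nat. strict_mono r \<and> (AE x in ?M. (\<lambda>k. (norm (\<phi> (r k) x - v x))\<^sup>2) \<longlonglongrightarrow> 0)"
  proof (rule tendsto_L1_AE_subseq)
    show "integrable ?M (\<lambda>x. (norm (\<phi> k x - v x))\<^sup>2)" for k
      using \<phi>L2 v' by (intro L2_integrable_sq L2_diff)
    show "(\<lambda>k. \<integral>x. norm ((norm (\<phi> k x - v x))\<^sup>2) \<partial>?M) \<longlonglongrightarrow> 0"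
      using tendsto_power[OF \<phi>0, of 2] by (simp add: L2_norm_sq)
  qed
  then obtain r :: "nat \<Rightarrow> nat" where r: "strict_mono r"
    and ae: "AE x in ?M. (\<lambda>k. (norm (\<phi> (r k) x - v x))\<^sup>2) \<longlonglongrightarrow> 0" by blast
  have mb: "(\<lambda>x. b (u x)) \<in> borel_measurable ?M" if "L2 \<Omega> u" for u
    using measurable_compose[OF L2_measurable[OF that] borel_measurable_continuous_onI[OF b_cont]] .
  have mA: "(\<lambda>x. A x *v w x) \<in> borel_measurable ?M" if "L2 \<Omega> A" for A :: "point \<Rightarrow> real^3^3"
  proof -
    have "(\<lambda>p::(real^3^3) \<times> (real^3). fst p *v snd p) \<in> borel_measurable borel"
      by (intro borel_measurable_continuous_onI) (auto intro!: continuous_intros simp: matrix_vector_mult_def)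
    from measurable_compose[OF borel_measurable_Pair[OF L2_measurable[OF that] L2_measurable[OF w(1)]] this]
    show ?thesis by simp
  qed
  have dom: "norm ((A x *v w x) \<bullet> y) \<le> C * (norm (A x) * norm (w x))"
    if "norm y \<le> C" for A :: "point \<Rightarrow> real^3^3" and x y C
  proof -
    have "norm ((A x *v w x) \<bullet> y) \<le> norm (A x *v w x) * norm y"
      by (simp add: Cauchy_Schwarz_ineq2)
    also have "\<dots> \<le> (norm (A x) * norm (w x)) * C"
      using that by (intro mult_mono norm_matrix_vector_mult_le) auto
    finally show ?thesis by (simp add: mult.commute)
  qed
  have int: "integrable ?M (\<lambda>x. (A x *v w x) \<bullet> b (u x))"
    if "L2 \<Omega> A" "L2 \<Omega> u" for A :: "point \<Rightarrow> real^3^3" and u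
  proof (rule Bochner_Integration.integrable_bound)
    show "integrable ?M (\<lambda>x. B * (norm (A x) * norm (w x)))"
      using L2_integrable_norm_mult[OF that(1) w(1)] by simp
    have "norm ((A x *v w x) \<bullet> b (u x)) \<le> norm (B * (norm (A x) * norm (w x)))" for x
      unfolding real_norm_def[of "B * _"] using dom[OF B] abs_ge_self by (rule order_trans)
    then show "AE x in ?M. norm ((A x *v w x) \<bullet> b (u x)) \<le> norm (B * (norm (A x) * norm (w x)))"
      by (rule AE_I2)
    show "(\<lambda>x. (A x *v w x) \<bullet> b (u x)) \<in> borel_measurable ?M"
      using mA[OF that(1)] mb[OF that(2)] by (rule borel_measurable_inner)
  qed
  have zero: "(\<integral>x. (field_grad (\<phi> k) x *v w x) \<bullet> b (\<phi> k x) \<partial>?M) = 0" for k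
  proof -
    obtain \<psi> where \<psi>: "test_fun \<Omega> \<psi>"
      "\<And>x w. w \<bullet> grad_test \<psi> x = (field_grad (\<phi> k) x *v w) \<bullet> b (\<phi> k x)"
      using damped_energy_test_fun[OF less_imp_le[OF e] \<phi>[of k]] unfolding b_def by metis
    have "(\<integral>x. w x \<bullet> grad_test \<psi> x \<partial>?M) = 0"
      using w(2) \<psi>(1) by (simp add: weak_div_free_def)
    then show ?thesis by (simp add: \<psi>(2))
  qed
  let ?J = "\<integral>x. (G x *v w x) \<bullet> b (v x) \<partial>?M"
  define E where "E k = (\<integral>x. (G x *v w x) \<bullet> (b (v x) - b (\<phi> k x)) \<partial>?M)" for k
  define F where "F k = (\<integral>x. ((field_grad (\<phi> k) x - G x) *v w x) \<bullet> b (\<phi> k x) \<partial>?M)" for k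
  have J: "?J = E k - F k" for k
  proof -
    have "E k = ?J - (\<integral>x. (G x *v w x) \<bullet> b (\<phi> k x) \<partial>?M)"
      unfolding E_def inner_diff_right
      by (intro Bochner_Integration.integral_diff int G v' \<phi>L2)
    moreover have "F k = (\<integral>x. (field_grad (\<phi> k) x *v w x) \<bullet> b (\<phi> k x) \<partial>?M) - (\<integral>x. (G x *v w x) \<bullet> b (\<phi> k x) \<partial>?M)"
      unfolding F_def matrix_vector_mult_diff_rdistrib inner_diff_left
      by (intro Bochner_Integration.integral_diff int G v' \<phi>L2)
    ultimately show ?thesis using zero[of k] by simp
  qed
  have "(\<lambda>k. E (r k)) \<longlonglongrightarrow> (\<integral>x. 0 \<partial>?M)"
    unfolding E_def
  proof (rule integral_dominated_convergence)
    show "integrable ?M (\<lambda>x. (B + B) * (norm (G x) * norm (w x)))"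
      using L2_integrable_norm_mult[OF G w(1)] by simp
    show "AE x in ?M. norm ((G x *v w x) \<bullet> (b (v x) - b (\<phi> (r k) x))) \<le> (B + B) * (norm (G x) * norm (w x))" for k
      by (intro AE_I2 dom norm_triangle_le_diff add_mono B)
    show "AE x in ?M. (\<lambda>k. (G x *v w x) \<bullet> (b (v x) - b (\<phi> (r k) x))) \<longlonglongrightarrow> 0"
      using ae
    proof eventually_elim
      case (elim x)
      have "(\<lambda>k. sqrt ((norm (\<phi> (r k) x - v x))\<^sup>2)) \<longlonglongrightarrow> sqrt 0"
        by (intro tendsto_intros elim)
      then have "(\<lambda>k. \<phi> (r k) x) \<longlonglongrightarrow> v x"
        by (simp add: tendsto_norm_zero_iff LIM_zero_iff)
      then have "(\<lambda>k. b (\<phi> (r k) x)) \<longlonglongrightarrow> b (v x)"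
        by (metis b_cont continuous_on_eq_continuous_at open_UNIV UNIV_I isCont_tendsto_compose)
      then have "(\<lambda>k. (G x *v w x) \<bullet> (b (v x) - b (\<phi> (r k) x))) \<longlonglongrightarrow> (G x *v w x) \<bullet> (b (v x) - b (v x))"
        by (intro tendsto_intros)
      then show ?case by simp
    qed
    show "(\<lambda>x. (G x *v w x) \<bullet> (b (v x) - b (\<phi> (r k) x))) \<in> borel_measurable ?M" for k
      by (intro borel_measurable_inner borel_measurable_diff mA mb G v' \<phi>L2)
  qed simp
  then have E: "(\<lambda>k. E (r k)) \<longlonglongrightarrow> 0" by simp
  have "norm (F k) \<le> B * (L2_norm \<Omega> (\<lambda>x. field_grad (\<phi> k) x - G x) * L2_norm \<Omega> w)" for k
  proof -
    have d: "L2 \<Omega> (\<lambda>x. field_grad (\<phi> k) x - G x)"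
      by (intro L2_diff \<phi>L2 G)
    have "norm (F k) \<le> (\<integral>x. B * (norm (field_grad (\<phi> k) x - G x) * norm (w x)) \<partial>?M)"
      unfolding F_def
    proof (rule Bochner_Integration.integral_norm_bound_integral)
      show "integrable ?M (\<lambda>x. ((field_grad (\<phi> k) x - G x) *v w x) \<bullet> b (\<phi> k x))"
        by (rule int[OF d \<phi>L2(1)])
      show "integrable ?M (\<lambda>x. B * (norm (field_grad (\<phi> k) x - G x) * norm (w x)))"
        using L2_integrable_norm_mult[OF d w(1)] by simp
      show "norm (((field_grad (\<phi> k) x - G x) *v w x) \<bullet> b (\<phi> k x)) \<le> B * (norm (field_grad (\<phi> k) x - G x) * norm (w x))" for x
        by (rule dom[OF B])
    qed
    also have "\<dots> = B * (\<integral>x. norm (field_grad (\<phi> k) x - G x) * norm (w x) \<partial>?M)" by simp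
    also have "\<dots> \<le> B * (L2_norm \<Omega> (\<lambda>x. field_grad (\<phi> k) x - G x) * L2_norm \<Omega> w)"
      by (intro mult_left_mono L2_Cauchy_Schwarz d w B0)
    finally show ?thesis .
  qed
  moreover have "(\<lambda>k. B * (L2_norm \<Omega> (\<lambda>x. field_grad (\<phi> k) x - G x) * L2_norm \<Omega> w)) \<longlonglongrightarrow> B * (0 * L2_norm \<Omega> w)"
    by (intro tendsto_intros \<phi>1)
  ultimately have "F \<longlonglongrightarrow> 0"
    by (intro Lim_null_comparison[of F]) auto
  then have "(\<lambda>k. F (r k)) \<longlonglongrightarrow> 0"
    using LIMSEQ_subseq_LIMSEQ[OF _ r] by (simp add: o_def)
  with E have "(\<lambda>k. E (r k) - F (r k)) \<longlonglongrightarrow> 0 - 0" by (rule tendsto_diff)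
  then have "(\<lambda>k::nat. ?J) \<longlonglongrightarrow> 0" by (simp add: J[symmetric])
  then show ?thesis by (simp add: LIMSEQ_const_iff b_def G_def)
qed

text \<open>In dimension three (w \<cdot> \<nabla>)v \<cdot> v with w merely in L^2 need not be integrable; in that case
  the Bochner integral is 0 by convention.\<close>

lemma convection_eq_0:
  assumes v: "H10 \<Omega> v" and w: "L2 \<Omega> w" "weak_div_free \<Omega> w"
  shows "(\<integral>x. (wgrad \<Omega> v x *v w x) \<bullet> v x \<partial>(lebesgue_on \<Omega>)) = 0"
proof (cases "integrable (lebesgue_on \<Omega>) (\<lambda>x. (wgrad \<Omega> v x *v w x) \<bullet> v x)")
  case True
  let ?f = "\<lambda>x. (wgrad \<Omega> v x *v w x) \<bullet> v x"
  define e where "e n = inverse (real (Suc n))" for n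
  have e: "e n > 0" for n by (simp add: e_def)
  have mv: "v \<in> borel_measurable (lebesgue_on \<Omega>)"
    using v by (intro L2_measurable) (simp add: H10_def H1_def)
  have "(\<lambda>n. \<integral>x. damping (e n) ((norm (v x))\<^sup>2) * ?f x \<partial>(lebesgue_on \<Omega>)) \<longlonglongrightarrow> (\<integral>x. ?f x \<partial>(lebesgue_on \<Omega>))"
  proof (rule integral_dominated_convergence)
    show "integrable (lebesgue_on \<Omega>) (\<lambda>x. norm (?f x))" using True by simp
    show "AE x in lebesgue_on \<Omega>. norm (damping (e n) ((norm (v x))\<^sup>2) * ?f x) \<le> norm (?f x)" for n
      using damping_bounds[of "e n"] e[of n] by (auto simp: abs_mult intro!: mult_left_le_one_le)
    show "AE x in lebesgue_on \<Omega>. (\<lambda>n. damping (e n) ((norm (v x))\<^sup>2) * ?f x) \<longlonglongrightarrow> ?f x"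
    proof (intro AE_I2)
      fix x
      have "(\<lambda>n. damping (e n) ((norm (v x))\<^sup>2) * ?f x) \<longlonglongrightarrow> inverse ((1 + 0 * (norm (v x))\<^sup>2)\<^sup>2) * ?f x"
        unfolding damping_def e_def by (intro tendsto_intros LIMSEQ_inverse_real_of_nat) auto
      then show "(\<lambda>n. damping (e n) ((norm (v x))\<^sup>2) * ?f x) \<longlonglongrightarrow> ?f x" by simp
    qed
    show "?f \<in> borel_measurable (lebesgue_on \<Omega>)" using True by simp
    then show "(\<lambda>x. damping (e n) ((norm (v x))\<^sup>2) * ?f x) \<in> borel_measurable (lebesgue_on \<Omega>)" for n
      unfolding damping_def using mv by measurable
  qed
  moreover have "(\<integral>x. damping (e n) ((norm (v x))\<^sup>2) * ?f x \<partial>(lebesgue_on \<Omega>)) = 0" for n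
    using damped_convection_eq_0[OF v w e[of n]] by simp
  ultimately show ?thesis by (simp add: LIMSEQ_const_iff)
qed (rule not_integrable_integral_eq)

text \<open>Needed for the first time step, where the advecting field \<open>w 0\<close> is the
  initial datum in V and not yet a projection onto H. Testing the diagonal entries of the weak
  gradient and summing gives the distributional divergence.\<close>

lemma Vsp_weak_div_free:
  assumes "Vsp \<Omega> v"
  shows "weak_div_free \<Omega> v"
  unfolding weak_div_free_def
proof (intro allI impI)
  fix \<phi> assume \<phi>: "test_fun \<Omega> \<phi>"
  let ?M = "lebesgue_on \<Omega>"
  have v: "H1 \<Omega> v" "L2 \<Omega> v" and div: "AE x in ?M. wdiv \<Omega> v x = 0"
    using assms by (auto simp: Vsp_def H10_def H1_def)
  have i1: "integrable ?M (\<lambda>x. v x $ j * partial j \<phi> x)" for j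
    by (intro integrable_mult_test_fun L2_integrable \<Omega> L2_vec_nth v test_fun_partial \<phi>)
  have i2: "integrable ?M (\<lambda>x. wgrad \<Omega> v x $ j $ j * \<phi> x)" for j
    by (intro integrable_mult_test_fun L2_integrable \<Omega> L2_vec_nth H1_wgrad(2) v \<phi>)
  have "(\<integral>x. v x \<bullet> grad_test \<phi> x \<partial>?M) = (\<integral>x. (\<Sum>j\<in>UNIV. v x $ j * partial j \<phi> x) \<partial>?M)"
    by (simp add: inner_vec_def grad_test_def)
  also have "\<dots> = (\<Sum>j\<in>UNIV. \<integral>x. v x $ j * partial j \<phi> x \<partial>?M)"
    using i1 by (intro Bochner_Integration.integral_sum)
  also have "\<dots> = (\<Sum>j\<in>UNIV. - (\<integral>x. wgrad \<Omega> v x $ j $ j * \<phi> x \<partial>?M))"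
    using H1_wgrad(1)[OF \<Omega> v(1)] \<phi>
    by (intro sum.cong) (auto simp: has_weak_grad_def has_weak_grad_scalar_def)
  also have "\<dots> = - (\<integral>x. (\<Sum>j\<in>UNIV. wgrad \<Omega> v x $ j $ j * \<phi> x) \<partial>?M)"
    using i2 by (simp add: sum_negf)
  also have "(\<integral>x. (\<Sum>j\<in>UNIV. wgrad \<Omega> v x $ j $ j * \<phi> x) \<partial>?M) = 0"
    by (rule integral_eq_zero_AE)
      (use div in \<open>eventually_elim, simp add: wdiv_def sum_distrib_right[symmetric]\<close>)
  finally show "(\<integral>x. v x \<bullet> grad_test \<phi> x \<partial>?M) = 0" by simp
qed

end

subsection \<open>Energy balance\<close>

lemma L2_inner_self: "L2_inner \<Omega> f f = (L2_norm \<Omega> f)\<^sup>2"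
  by (simp add: L2_inner_def L2_norm_sq power2_norm_eq_inner)

text \<open>Polarization. It serves both the projection and the discrete time derivative, and is the
  source of the two sums of squared increments in the estimate.\<close>

lemma L2_norm_sq_diff:
  assumes "L2 \<Omega> f" "L2 \<Omega> g"
  shows "2 * L2_inner \<Omega> (\<lambda>x. f x - g x) f
    = (L2_norm \<Omega> f)\<^sup>2 - (L2_norm \<Omega> g)\<^sup>2 + (L2_norm \<Omega> (\<lambda>x. f x - g x))\<^sup>2"
proof -
  have "2 * L2_inner \<Omega> (\<lambda>x. f x - g x) f = (\<integral>x. 2 * ((f x - g x) \<bullet> f x) \<partial>(lebesgue_on \<Omega>))"
    by (simp add: L2_inner_def)
  also have "\<dots> = (\<integral>x. (norm (f x))\<^sup>2 - (norm (g x))\<^sup>2 + (norm (f x - g x))\<^sup>2 \<partial>(lebesgue_on \<Omega>))"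
    by (intro Bochner_Integration.integral_cong) (auto simp: power2_norm_eq_inner inner_simps inner_commute)
  also have "\<dots> = (L2_norm \<Omega> f)\<^sup>2 - (L2_norm \<Omega> g)\<^sup>2 + (L2_norm \<Omega> (\<lambda>x. f x - g x))\<^sup>2"
    using L2_integrable_sq[OF assms(1)] L2_integrable_sq[OF assms(2)] L2_integrable_sq[OF L2_diff[OF assms]]
    by (simp add: L2_norm_sq)
  finally show ?thesis .
qed

lemma L2_inner_le:
  assumes "L2 \<Omega> f" "L2 \<Omega> g"
  shows "2 * L2_inner \<Omega> f g \<le> (L2_norm \<Omega> f)\<^sup>2 + (L2_norm \<Omega> g)\<^sup>2"
proof -
  have "2 * L2_inner \<Omega> f g = (\<integral>x. 2 * (f x \<bullet> g x) \<partial>(lebesgue_on \<Omega>))"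
    by (simp add: L2_inner_def)
  also have "\<dots> \<le> (\<integral>x. (norm (f x))\<^sup>2 + (norm (g x))\<^sup>2 \<partial>(lebesgue_on \<Omega>))"
  proof (rule integral_mono)
    show "2 * (f x \<bullet> g x) \<le> (norm (f x))\<^sup>2 + (norm (g x))\<^sup>2" for x
      using zero_le_power2[of "norm (f x - g x)"] by (simp add: power2_norm_eq_inner inner_simps inner_commute)
  qed (use assms in \<open>auto intro!: L2_integrable_sq L2_integrable_inner\<close>)
  also have "\<dots> = (L2_norm \<Omega> f)\<^sup>2 + (L2_norm \<Omega> g)\<^sup>2"
    using assms by (simp add: L2_norm_sq L2_integrable_sq)
  finally show ?thesis .
qed

text \<open>Convexity of the squared norm with its explicit pointwise defect c (1 - c) |f - g|^2. It
  carries the bound for the filtered field over to the relaxed field \<open>u\<close>.\<close>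

lemma L2_norm_convex_comb_le:
  assumes "L2 \<Omega> f" "L2 \<Omega> g" "0 \<le> c" "c \<le> 1" "L2_norm \<Omega> g \<le> L2_norm \<Omega> f"
  shows "L2_norm \<Omega> (\<lambda>x. (1 - c) *\<^sub>R f x + c *\<^sub>R g x) \<le> L2_norm \<Omega> f"
proof -
  have "(L2_norm \<Omega> (\<lambda>x. (1 - c) *\<^sub>R f x + c *\<^sub>R g x))\<^sup>2
      \<le> (\<integral>x. (1 - c) * (norm (f x))\<^sup>2 + c * (norm (g x))\<^sup>2 \<partial>(lebesgue_on \<Omega>))"
    unfolding L2_norm_sq
  proof (rule integral_mono)
    fix x
    have "(1 - c) * (norm (f x))\<^sup>2 + c * (norm (g x))\<^sup>2 - (norm ((1 - c) *\<^sub>R f x + c *\<^sub>R g x))\<^sup>2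
        = c * (1 - c) * (norm (f x - g x))\<^sup>2"
      by (simp add: power2_norm_eq_inner inner_simps inner_commute algebra_simps)
    moreover have "0 \<le> c * (1 - c) * (norm (f x - g x))\<^sup>2" using assms by simp
    ultimately show "(norm ((1 - c) *\<^sub>R f x + c *\<^sub>R g x))\<^sup>2 \<le> (1 - c) * (norm (f x))\<^sup>2 + c * (norm (g x))\<^sup>2"
      by linarith
  qed (use assms in \<open>auto intro!: L2_integrable_sq L2_add L2_scaleR\<close>)
  also have "\<dots> = (1 - c) * (L2_norm \<Omega> f)\<^sup>2 + c * (L2_norm \<Omega> g)\<^sup>2"
    using assms by (simp add: L2_norm_sq L2_integrable_sq)
  also have "\<dots> \<le> (1 - c) * (L2_norm \<Omega> f)\<^sup>2 + c * (L2_norm \<Omega> f)\<^sup>2"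
    using assms L2_norm_nonneg by (intro add_left_mono mult_left_mono power_mono) auto
  also have "\<dots> = (L2_norm \<Omega> f)\<^sup>2" by (simp add: algebra_simps)
  finally show ?thesis using L2_norm_nonneg power2_le_imp_le by blast
qed

text \<open>A real supremum is an upper bound only for a set bounded above, which
  \<open>in_dual\<close> guarantees. Fields with zero gradient norm are outside that set; for them
  the bound in \<open>in_dual\<close> forces F v = 0.\<close>

lemma dual_norm_bound:
  assumes F: "in_dual \<Omega> F" and v: "H10 \<Omega> v"
  shows "\<bar>F v\<bar> \<le> dual_norm \<Omega> F * L2_norm \<Omega> (wgrad \<Omega> v)"
proof -
  obtain C where C: "\<And>v. H10 \<Omega> v \<Longrightarrow> \<bar>F v\<bar> \<le> C * L2_norm \<Omega> (wgrad \<Omega> v)"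
    using F by (auto simp: in_dual_def)
  show ?thesis
  proof (cases "L2_norm \<Omega> (wgrad \<Omega> v) = 0")
    case True
    then show ?thesis using C[OF v] by simp
  next
    case False
    let ?S = "{\<bar>F v\<bar> / L2_norm \<Omega> (wgrad \<Omega> v) | v. H10 \<Omega> v \<and> L2_norm \<Omega> (wgrad \<Omega> v) \<noteq> 0}"
    have "bdd_above ?S"
    proof (rule bdd_aboveI)
      fix y assume "y \<in> ?S"
      then obtain u where "y = \<bar>F u\<bar> / L2_norm \<Omega> (wgrad \<Omega> u)" "H10 \<Omega> u" "L2_norm \<Omega> (wgrad \<Omega> u) > 0"
        using L2_norm_nonneg by (auto simp: less_le)
      then show "y \<le> C" using C[of u] by (simp add: divide_le_eq)
    qed
    then have "\<bar>F v\<bar> / L2_norm \<Omega> (wgrad \<Omega> v) \<le> dual_norm \<Omega> F"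
      unfolding dual_norm_def using v False by (intro cSup_upper) auto
    moreover have "L2_norm \<Omega> (wgrad \<Omega> v) > 0"
      using False L2_norm_nonneg[of \<Omega> "wgrad \<Omega> v"] by linarith
    ultimately show ?thesis by (simp add: divide_le_eq)
  qed
qed

theorem mainTheorem4:
  fixes \<Omega> :: "(real^3) set"
    and \<nu> \<Delta>t chi \<delta> \<epsilon> :: real
    and a :: "field \<Rightarrow> real^3 \<Rightarrow> real"
    and f :: "real \<Rightarrow> field \<Rightarrow> real"
    and u0 :: field
    and wt w wbar u :: "nat \<Rightarrow> field"
    and l :: nat
  assumes dom: "open \<Omega>" "connected \<Omega>" "bounded \<Omega>" "\<Omega> \<noteq> {}"
    and nu: "\<nu> > 0" and dt: "\<Delta>t > 0"
    and chi: "0 \<le> chi" "chi \<le> 1"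
    and eps: "\<epsilon> > 0"
    and a_meas: "\<And>v. a v \<in> borel_measurable (lebesgue_on \<Omega>)"
    and a_range: "\<And>v x. x \<in> \<Omega> \<Longrightarrow> \<epsilon> \<le> a v x \<and> a v x \<le> 1"
    and f_dual: "\<And>t. in_dual \<Omega> (f t)"
    and u0: "Vsp \<Omega> u0"
    and init: "u 0 = u0" "w 0 = u0" "wt 0 = u0"
    and step1: "\<And>n. H10 \<Omega> (wt (Suc n)) \<and>
      (\<forall>v. H10 \<Omega> v \<longrightarrow>
         (1 / \<Delta>t) * L2_inner \<Omega> (\<lambda>x. wt (Suc n) x - u n x) v
         + (\<integral>x. (wgrad \<Omega> (wt (Suc n)) x *v w n x) \<bullet> v x \<partial>(lebesgue_on \<Omega>))
         + \<nu> * L2_inner \<Omega> (wgrad \<Omega> (wt (Suc n))) (wgrad \<Omega> v)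
         = f (real (Suc n) * \<Delta>t) v)"
    and step2: "\<And>n. Hsp \<Omega> (w (Suc n)) \<and>
      (\<forall>v. Hsp \<Omega> v \<longrightarrow> L2_inner \<Omega> (\<lambda>x. wt (Suc n) x - w (Suc n) x) v = 0)"
    and step3: "\<And>n. Vsp \<Omega> (wbar (Suc n)) \<and>
      (\<forall>v. Vsp \<Omega> v \<longrightarrow>
         (\<integral>x. \<delta>\<^sup>2 * a (w (Suc n)) x * (wgrad \<Omega> (wbar (Suc n)) x \<bullet> wgrad \<Omega> v x) \<partial>(lebesgue_on \<Omega>))
         + L2_inner \<Omega> (wbar (Suc n)) v
         = L2_inner \<Omega> (w (Suc n)) v)"
    and step4: "\<And>n. u (Suc n) = (\<lambda>x. (1 - chi) *\<^sub>R w (Suc n) x + chi *\<^sub>R wbar (Suc n) x)"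
    and l: "l \<ge> 1"
  shows "(L2_norm \<Omega> (w l))\<^sup>2
    + (\<Sum>n<l. (L2_norm \<Omega> (\<lambda>x. w (Suc n) x - wt (Suc n) x))\<^sup>2)
    + (\<Sum>n<l. (L2_norm \<Omega> (\<lambda>x. wt (Suc n) x - u n x))\<^sup>2)
    + (\<Sum>n<l. \<nu> * \<Delta>t * (L2_norm \<Omega> (wgrad \<Omega> (wt (Suc n))))\<^sup>2)
    \<le> (L2_norm \<Omega> (w 0))\<^sup>2
    + (\<Sum>n<l. \<Delta>t / \<nu> * (dual_norm \<Omega> (f (real (Suc n) * \<Delta>t)))\<^sup>2)"
proof -
  note \<Omega> = dom(1,3)
  have w_L2: "L2 \<Omega> (w n)" and w_div: "weak_div_free \<Omega> (w n)" for n
  proof -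
    have "L2 \<Omega> (w n) \<and> weak_div_free \<Omega> (w n)"
    proof (cases n)
      case 0
      then show ?thesis
        using u0 init Vsp_weak_div_free[OF \<Omega> u0] by (simp add: Vsp_def H10_def H1_def)
    next
      case (Suc m)
      then show ?thesis using step2[of m] by (simp add: Hsp_def)
    qed
    then show "L2 \<Omega> (w n)" "weak_div_free \<Omega> (w n)" by auto
  qed
  have wt: "H10 \<Omega> (wt (Suc n))" "L2 \<Omega> (wt (Suc n))" for n
    using step1[of n] by (auto simp: H10_def H1_def)
  have wbar_L2: "L2 \<Omega> (wbar (Suc n))" for n
    using step3[of n] by (auto simp: Vsp_def H10_def H1_def)
  have wbar_le: "L2_norm \<Omega> (wbar (Suc n)) \<le> L2_norm \<Omega> (w (Suc n))" for n
  proof -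
    let ?I = "\<integral>x. \<delta>\<^sup>2 * a (w (Suc n)) x * (wgrad \<Omega> (wbar (Suc n)) x \<bullet> wgrad \<Omega> (wbar (Suc n)) x) \<partial>(lebesgue_on \<Omega>)"
    have "?I \<ge> 0"
    proof (rule Bochner_Integration.integral_nonneg_AE, rule AE_I2)
      fix x assume "x \<in> space (lebesgue_on \<Omega>)"
      then have "0 \<le> a (w (Suc n)) x"
        using a_range[of x "w (Suc n)"] eps by auto
      then show "0 \<le> \<delta>\<^sup>2 * a (w (Suc n)) x * (wgrad \<Omega> (wbar (Suc n)) x \<bullet> wgrad \<Omega> (wbar (Suc n)) x)"
        by simp
    qed
    moreover have "?I + (L2_norm \<Omega> (wbar (Suc n)))\<^sup>2 = L2_inner \<Omega> (w (Suc n)) (wbar (Suc n))"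
      using step3[of n] by (simp add: L2_inner_self[symmetric])
    \<comment> \<open>The mixed term is at most half the sum of the two squared norms, and the half
      belonging to \<open>wbar (Suc n)\<close> is absorbed on the left.\<close>
    ultimately have "(L2_norm \<Omega> (wbar (Suc n)))\<^sup>2 \<le> (L2_norm \<Omega> (w (Suc n)))\<^sup>2"
      using L2_inner_le[OF w_L2[of "Suc n"] wbar_L2[of n]] by linarith
    then show ?thesis using L2_norm_nonneg power2_le_imp_le by blast
  qed
  have u_L2: "L2 \<Omega> (u n)" and u_le: "L2_norm \<Omega> (u n) \<le> L2_norm \<Omega> (w n)" for n
  proof -
    have "L2 \<Omega> (u n) \<and> L2_norm \<Omega> (u n) \<le> L2_norm \<Omega> (w n)"
    proof (cases n)
      case 0
      then show ?thesis using w_L2[of 0] init by simp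
    next
      case (Suc m)
      then show ?thesis
        using L2_norm_convex_comb_le[OF w_L2 wbar_L2 chi wbar_le] L2_add[OF L2_scaleR[OF w_L2] L2_scaleR[OF wbar_L2]]
        by (simp add: step4)
    qed
    then show "L2 \<Omega> (u n)" "L2_norm \<Omega> (u n) \<le> L2_norm \<Omega> (w n)" by auto
  qed
  have step: "(L2_norm \<Omega> (w (Suc n)))\<^sup>2 + (L2_norm \<Omega> (\<lambda>x. w (Suc n) x - wt (Suc n) x))\<^sup>2
      + (L2_norm \<Omega> (\<lambda>x. wt (Suc n) x - u n x))\<^sup>2 + \<nu> * \<Delta>t * (L2_norm \<Omega> (wgrad \<Omega> (wt (Suc n))))\<^sup>2
      \<le> (L2_norm \<Omega> (w n))\<^sup>2 + \<Delta>t / \<nu> * (dual_norm \<Omega> (f (real (Suc n) * \<Delta>t)))\<^sup>2" for n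
  proof -
    let ?F = "f (real (Suc n) * \<Delta>t)" and ?W = "wt (Suc n)"
    define D where "D = dual_norm \<Omega> ?F"
    define g where "g = L2_norm \<Omega> (wgrad \<Omega> ?W)"
    have "L2_inner \<Omega> (\<lambda>x. ?W x - w (Suc n) x) (w (Suc n)) = 0"
      using step2[of n] by blast
    moreover have "L2_inner \<Omega> (\<lambda>x. ?W x - w (Suc n) x) (w (Suc n)) = - L2_inner \<Omega> (\<lambda>x. w (Suc n) x - ?W x) (w (Suc n))"
      unfolding L2_inner_def Bochner_Integration.integral_minus[symmetric]
      by (rule Bochner_Integration.integral_cong) (auto simp: inner_diff_left)
    ultimately have proj: "(L2_norm \<Omega> (w (Suc n)))\<^sup>2 + (L2_norm \<Omega> (\<lambda>x. w (Suc n) x - ?W x))\<^sup>2 = (L2_norm \<Omega> ?W)\<^sup>2"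
      using L2_norm_sq_diff[OF w_L2[of "Suc n"] wt(2)[of n]] by linarith
    have "(1 / \<Delta>t) * L2_inner \<Omega> (\<lambda>x. ?W x - u n x) ?W + \<nu> * g\<^sup>2 = ?F ?W"
      using step1[of n, THEN conjunct2, rule_format, OF wt(1)[of n]] convection_eq_0[OF \<Omega> wt(1)[of n] w_L2[of n] w_div[of n]]
      by (simp add: L2_inner_self g_def)
    then have "L2_inner \<Omega> (\<lambda>x. ?W x - u n x) ?W + \<nu> * \<Delta>t * g\<^sup>2 = \<Delta>t * ?F ?W"
      using dt by (simp add: field_simps)
    also have "\<dots> \<le> \<Delta>t * (D * g)"
      using dual_norm_bound[OF f_dual wt(1)] dt
      by (intro mult_left_mono) (auto simp: D_def g_def abs_le_iff)
    finally have "(L2_norm \<Omega> ?W)\<^sup>2 - (L2_norm \<Omega> (u n))\<^sup>2 + (L2_norm \<Omega> (\<lambda>x. ?W x - u n x))\<^sup>2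
        + 2 * (\<nu> * \<Delta>t * g\<^sup>2) \<le> 2 * (\<Delta>t * (D * g))"
      using L2_norm_sq_diff[OF wt(2)[of n] u_L2[of n]] by linarith
    \<comment> \<open>Young's inequality weighted to spend exactly one of the two copies of \<nu>
      \<Delta>t g^2 on the left. The other copy is the dissipation in the claim, and the price is
      the factor \<Delta>t / \<nu>.\<close>
    moreover have "2 * (\<Delta>t * (D * g)) \<le> \<nu> * \<Delta>t * g\<^sup>2 + \<Delta>t / \<nu> * D\<^sup>2"
    proof -
      have "\<nu> * \<Delta>t * g\<^sup>2 + \<Delta>t / \<nu> * D\<^sup>2 - 2 * (\<Delta>t * (D * g)) = \<Delta>t / \<nu> * (\<nu> * g - D)\<^sup>2"
        using nu by (simp add: field_simps power2_eq_square)
      moreover have "0 \<le> \<Delta>t / \<nu> * (\<nu> * g - D)\<^sup>2" using nu dt by simp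
      ultimately show ?thesis by linarith
    qed
    \<comment> \<open>Trading \<open>u n\<close> for \<open>w n\<close> makes the one-step
      inequality telescope in n.\<close>
    moreover have "(L2_norm \<Omega> (u n))\<^sup>2 \<le> (L2_norm \<Omega> (w n))\<^sup>2"
      using u_le L2_norm_nonneg by (rule power_mono)
    ultimately show ?thesis
      using proj unfolding D_def[symmetric] g_def[symmetric] by linarith
  qed
  show ?thesis
  proof (induction l)
    case (Suc l)
    then show ?case using step[of l] by simp
  qed simp
qed

end
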